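(* Let $G$ be a finite group of order $1092$. Then $\Omega_{\rho}(L_2(13))\leq\Omega_{\rho}(G)$, and $\Omega_{\rho}(G)=1273$ if and only if $G\cong L_2(13)$.
   Context: For a finite group $G$, let $o(x)$ denote the order of $x\in G$ and set $\rho(G)=\prod_{x\in G} o(x)$. For a positive integer $m=p_1^{\alpha_1}\cdots p_k^{\alpha_k}$ with $p_1,\dots,p_k$ distinct primes, $\Omega(m)=\alpha_1+\cdots+\alpha_k$ is the number of prime factors of $m$ counted with multiplicity (so $\Omega(1)=0$). Define $\Omega_{\rho}(G)=\Omega(\rho(G))$. $L_2(q)=\mathrm{PSL}(2,q)$ denotes the projective special linear group of degree $2$ over the field with $q$ elements; $|L_2(13)|=1092$. *)

theory Defs
  imports
    "HOL-Analysis.Determinants"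
    "HOL-Algebra.Coset"
    "HOL-Algebra.Multiplicative_Group"
    "HOL-Computational_Algebra.Primes"
begin

definition Omega :: "nat \<Rightarrow> nat"
  where "Omega m = size (prime_factorization m)"

definition rho :: "('a, 'b) monoid_scheme \<Rightarrow> nat"
  where "rho G = (\<Prod>x\<in>carrier G. group.ord G x)"

definition Omega_rho :: "('a, 'b) monoid_scheme \<Rightarrow> nat"
  where "Omega_rho G = Omega (rho G)"

definition group_center :: "('a, 'b) monoid_scheme \<Rightarrow> 'a set"
  where "group_center G =
    {z \<in> carrier G. \<forall>x\<in>carrier G. z \<otimes>\<^bsub>G\<^esub> x = x \<otimes>\<^bsub>G\<^esub> z}"

definition SL :: "('f::field^'n^'n) monoid"
  where "SL = \<lparr>carrier = {A. det A = 1}, mult = (**), one = mat 1\<rparr>"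

definition PSL :: "('f::field^'n^'n) set monoid"
  where "PSL = SL Mod (group_center SL)"

text \<open>The field enters as a type: \<open>L2 TYPE('f)\<close> is $L_2(q)$ whenever \<open>CARD('f) = q\<close>.\<close>

definition L2 :: "'f::field itself \<Rightarrow> ('f^2^2) set monoid"
  where "L2 _ = PSL"

lemma group_SL: "group (SL :: ('f::field^'n^'n) monoid)"
proof (rule groupI)
  fix A :: "'f^'n^'n"
  assume "A \<in> carrier SL"
  then have A: "det A = 1"
    by (simp add: SL_def)
  then have "invertible A"
    by (simp add: invertible_det_nz)
  then obtain B where B: "B ** A = mat 1"
    unfolding invertible_def by blast
  then have "det B * det A = 1"
    by (metis det_I det_mul)
  with A B show "\<exists>B\<in>carrier SL. B \<otimes>\<^bsub>SL\<^esub> A = \<one>\<^bsub>SL\<^esub>"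
    by (auto simp: SL_def)
qed (auto simp: SL_def det_mul matrix_mul_assoc)

lemma normal_group_center:
  fixes G (structure)
  assumes "group G"
  shows "group_center G \<lhd> G"
proof -
  interpret group G by fact
  have inv_closed: "inv z \<in> group_center G" if "z \<in> group_center G" for z
  proof -
    have z: "z \<in> carrier G" "\<And>x. x \<in> carrier G \<Longrightarrow> z \<otimes> x = x \<otimes> z"
      using that by (auto simp: group_center_def)
    have "inv z \<otimes> x = x \<otimes> inv z" if x: "x \<in> carrier G" for x
    proof -
      have "x = z \<otimes> (x \<otimes> inv z)"
        using z(2)[of "x \<otimes> inv z"] z(1) x by (simp add: m_assoc)
      then show ?thesis
        using z(1) x by (simp add: inv_solve_left')
    qed
    with z show ?thesis
      by (simp add: group_center_def)
  qed
  have mult_closed: "y \<otimes> z \<in> group_center G"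
    if "y \<in> group_center G" "z \<in> group_center G" for y z
  proof -
    have yz: "y \<in> carrier G" "z \<in> carrier G"
      "\<And>x. x \<in> carrier G \<Longrightarrow> y \<otimes> x = x \<otimes> y"
      "\<And>x. x \<in> carrier G \<Longrightarrow> z \<otimes> x = x \<otimes> z"
      using that by (auto simp: group_center_def)
    have "y \<otimes> z \<otimes> x = x \<otimes> (y \<otimes> z)" if x: "x \<in> carrier G" for x
    proof -
      have "y \<otimes> z \<otimes> x = y \<otimes> x \<otimes> z"
        using yz(1,2) x by (simp add: m_assoc yz(4)[OF x])
      also have "\<dots> = x \<otimes> (y \<otimes> z)"
        using yz(1,2) x by (simp add: m_assoc yz(3)[OF x])
      finally show ?thesis .
    qed
    with yz(1,2) show ?thesis
      by (simp add: group_center_def)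
  qed
  have "\<one> \<in> group_center G"
    by (simp add: group_center_def)
  moreover have "group_center G \<subseteq> carrier G"
    by (auto simp: group_center_def)
  ultimately have sub: "subgroup (group_center G) G"
    using inv_closed mult_closed by (intro subgroupI) blast+
  have "x \<otimes> h \<otimes> inv x \<in> group_center G"
    if x: "x \<in> carrier G" and h: "h \<in> group_center G" for x h
  proof -
    have hG: "h \<in> carrier G" and hx: "x \<otimes> h = h \<otimes> x"
      using x h by (simp_all add: group_center_def)
    have "x \<otimes> h \<otimes> inv x = h"
      unfolding hx using hG x by (simp add: m_assoc)
    with h show ?thesis by simp
  qed
  with sub show ?thesis
    by (simp add: normal_inv_iff)
qed

lemma group_PSL: "group (PSL :: ('f::field^'n^'n) set monoid)"
  unfolding PSL_def by (intro normal.factorgroup_is_group normal_group_center group_SL)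

end

theory Submission
  imports Defs "HOL-Algebra.Sylow" "HOL-Number_Theory.Residues"
begin

text \<open>
  Since \<open>rho G\<close> is a product, \<open>Omega_rho G\<close> is the sum of \<open>Omega (ord g)\<close> over all elements
  (\<open>Omega_rho_eq_sum\<close>). Each of the 1091 non-identity elements contributes at least 1, and an element of
  composite order contributes at least 2, so \<open>Omega_rho G\<close> is at least 1091 plus the number of elements of
  composite order (\<open>Omega_rho_ge\<close>). In $L_2(13)$ the composite orders are the order 6 of exactly 182
  elements, and $1091 + 182 = 1273$. It remains to find more than 182 elements of composite order in every other
  group of order $1092 = 2^2 \cdot 3 \cdot 7 \cdot 13$.

  Fix an element \<open>x\<close> of order 13 and let $C \le N$ be the centralizer and the normalizer of
  $P = \langle x \rangle$. Counting double cosets $P g N$ shows that $|N|$ is 1092 or 78. A central element of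
  prime order $p$ in a group of order $pm$ with $p \nmid m$ forces $(p-1)(m-1)$ elements of composite order
  (\<open>card_mixed\<close>), because it can be multiplied with the elements of order prime to $p$. Applied to $C$,
  this settles the groups in which $P$ is normal, together with the elements that act on $P$ with order 6, and
  the groups with $|N| = 78$ and $C > P$, where conjugation multiplies the count by 14
  (\<open>Omega_rho_gt\<close>); if $|C| = 26$, the involution of $C$ is central in $N$ and yields the elements that are
  still missing.

  Suppose finally that $|N| = 78$ and $C = P$. The 14 cosets of $N$ are labelled by the projective line over the
  field with 13 elements (the type \<open>'f option\<close>, with \<open>None\<close> as the point at infinity) so that $P$ acts by
  translations and $N$ by the maps $z \mapsto az + b$ with $a$ a nonzero square. Only the identity fixes three
  points. Lower bounds for the number of elements of order 13, 7, 6, and 2 or 3 add up to 1091, hence all of them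
  are equalities: \<open>Omega_rho G\<close> is 1273, and every element of order 2, 3 or 6 has a fixed point
  (\<open>orders\<close>). An element that swaps infinity and 0 therefore fixes a point, and this makes it invert the
  stabilizer of the two points. Up to a scaling of the line this determines the map on the squares, and since
  only the identity fixes three points it must be $z \mapsto -1/z$ (\<open>neg_inverse_unique\<close>). So $G$ acts
  faithfully by Moebius transformations of determinant 1, and by order it is the group \<open>Mob\<close> of all of them
  (\<open>iso_Mob\<close>), which is $L_2(13)$ (\<open>L2_iso_Mob\<close>). The group \<open>Mob\<close> falls itself under this case, which
  gives its value 1273.
\<close>

section \<open>Cyclic subgroups, centralizers and normalizers in finite groups\<close>

context group
begin

definition powers :: "'a \<Rightarrow> 'a set"
  where "powers x = range (\<lambda>k::nat. x [^] k)"

definition centralizer :: "'a \<Rightarrow> 'a set"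
  where "centralizer x = {g \<in> carrier G. g \<otimes> x = x \<otimes> g}"

text \<open>The normalizer of the cyclic subgroup generated by \<open>x\<close>: in a finite group it is enough that the conjugate of
  the generator stays in the subgroup.\<close>
definition normalizer :: "'a \<Rightarrow> 'a set"
  where "normalizer x = {g \<in> carrier G. g \<otimes> x \<otimes> inv g \<in> powers x}"

lemma inv_mult_cancel:
  assumes "g \<in> carrier G" "y \<in> carrier G"
  shows "inv g \<otimes> (g \<otimes> y) = y" "g \<otimes> (inv g \<otimes> y) = y"
  using assms by (simp_all flip: m_assoc)

lemma conj_mult:
  assumes "g \<in> carrier G" "x \<in> carrier G" "y \<in> carrier G"
  shows "g \<otimes> (x \<otimes> y) \<otimes> inv g = (g \<otimes> x \<otimes> inv g) \<otimes> (g \<otimes> y \<otimes> inv g)"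
  using assms by (simp add: m_assoc inv_mult_cancel)

lemma conj_pow:
  assumes "g \<in> carrier G" "x \<in> carrier G"
  shows "(g \<otimes> x \<otimes> inv g) [^] (k::nat) = g \<otimes> x [^] k \<otimes> inv g"
  by (induction k) (use assms in \<open>simp_all add: conj_mult\<close>)

lemma conj_conj:
  assumes "g \<in> carrier G" "h \<in> carrier G" "x \<in> carrier G"
  shows "g \<otimes> (h \<otimes> x \<otimes> inv h) \<otimes> inv g = (g \<otimes> h) \<otimes> x \<otimes> inv (g \<otimes> h)"
  using assms by (simp add: m_assoc inv_mult_group)

lemma conj_inv_cancel:
  assumes "g \<in> carrier G" "x \<in> carrier G"
  shows "inv g \<otimes> (g \<otimes> x \<otimes> inv g) \<otimes> g = x"
  using assms by (simp add: m_assoc inv_mult_cancel)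

lemma conj_eq_iff:
  assumes "g \<in> carrier G" "x \<in> carrier G" "y \<in> carrier G"
  shows "g \<otimes> x \<otimes> inv g = g \<otimes> y \<otimes> inv g \<longleftrightarrow> x = y"
  using assms conj_inv_cancel by metis

lemma conj_eq_one_iff:
  assumes "g \<in> carrier G" "x \<in> carrier G"
  shows "g \<otimes> x \<otimes> inv g = \<one> \<longleftrightarrow> x = \<one>"
  using conj_eq_iff[OF assms one_closed] assms by simp

lemma conj_eq_self_iff:
  assumes "g \<in> carrier G" "x \<in> carrier G"
  shows "g \<otimes> x \<otimes> inv g = x \<longleftrightarrow> g \<otimes> x = x \<otimes> g"
  using assms by (metis inv_solve_right' m_closed)

lemma ord_conj:
  assumes "g \<in> carrier G" "x \<in> carrier G"
  shows "ord (g \<otimes> x \<otimes> inv g) = ord x"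
  using assms by (subst ord_unique) (simp_all add: conj_pow conj_eq_one_iff pow_eq_id)

lemma ord_prime_if:
  assumes "x \<in> carrier G" "prime p" "x [^] p = \<one>" "x \<noteq> \<one>"
  shows "ord x = p"
  using assms by (metis ord_eq_1 pow_eq_id prime_nat_iff)

lemma pow_eq_mod: "y \<in> carrier G \<Longrightarrow> y [^] (i::nat) = y [^] j \<longleftrightarrow> i mod ord y = j mod ord y"
proof -
  assume y: "y \<in> carrier G"
  have "y [^] i = y [^] j \<longleftrightarrow> y [^] int i = y [^] int j" by (simp add: int_pow_int)
  also have "\<dots> \<longleftrightarrow> int (ord y) dvd int j - int i" using y by (simp add: int_pow_eq)
  also have "\<dots> \<longleftrightarrow> int j mod int (ord y) = int i mod int (ord y)" by (simp only: mod_eq_dvd_iff)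
  also have "\<dots> \<longleftrightarrow> i mod ord y = j mod ord y" unfolding zmod_int[symmetric] by auto
  finally show ?thesis .
qed

lemma ord_subgroup:
  assumes "subgroup H G" "x \<in> H"
  shows "group.ord (G\<lparr>carrier := H\<rparr>) x = ord x"
proof -
  interpret H: group "G\<lparr>carrier := H\<rparr>" using assms(1) by (rule subgroup_imp_group)
  show ?thesis
    using assms by (subst H.ord_unique) (simp_all flip: nat_pow_consistent add: pow_eq_id subgroup.mem_carrier)
qed

lemma ord_dvd_card:
  assumes "subgroup H G" "x \<in> H"
  shows "ord x dvd card H"
proof -
  interpret H: group "G\<lparr>carrier := H\<rparr>" using assms(1) by (rule subgroup_imp_group)
  show ?thesis using H.ord_dvd_group_order[of x] assms by (simp add: ord_subgroup order_def)
qed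

lemma subgroup_card_dvd:
  assumes "subgroup H G" "subgroup K G" "H \<subseteq> K"
  shows "card H dvd card K"
proof -
  interpret K: group "G\<lparr>carrier := K\<rparr>" using assms(2) by (rule subgroup_imp_group)
  have "subgroup H (G\<lparr>carrier := K\<rparr>)" using assms by (simp add: subgroup_incl)
  from K.lagrange[OF this] have "card (rcosets\<^bsub>G\<lparr>carrier := K\<rparr>\<^esub> H) * card H = card K" by (simp add: order_def)
  then show ?thesis by (metis dvd_triv_right)
qed

lemma Cauchy:
  assumes "finite (carrier G)" "prime p" "p dvd order G"
  shows "\<exists>x\<in>carrier G. ord x = p"
proof -
  obtain m where m: "order G = p ^ 1 * m" using assms(3) by (auto simp: dvd_def)
  obtain H where H: "subgroup H G" "card H = p"
    using sylow_thm[OF assms(2) is_group m assms(1)] by auto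
  have "H \<noteq> {\<one>}" using H assms(2) by auto
  then obtain x where x: "x \<in> H" "x \<noteq> \<one>" using subgroup.one_closed[OF H(1)] by blast
  have "x \<in> carrier G" using H(1) x(1) by (simp add: subgroup.mem_carrier)
  moreover have "ord x dvd p" using ord_dvd_card[OF H(1) x(1)] H(2) by simp
  ultimately have "ord x = p" using assms(2) x(2) by (metis ord_eq_1 prime_nat_iff)
  then show ?thesis using \<open>x \<in> carrier G\<close> by blast
qed

text \<open>The quotient \<open>D / Z\<close> has order \<open>m\<close>, so the \<open>m\<close>-th power of each of its elements is trivial.\<close>
lemma pow_index_in_normal:
  assumes fin: "finite (carrier G)" and D: "subgroup D G" and Z: "subgroup Z G" "Z \<subseteq> D"
    and nor: "\<And>g z. g \<in> D \<Longrightarrow> z \<in> Z \<Longrightarrow> g \<otimes> z \<otimes> inv g \<in> Z"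
    and card: "card D = card Z * m" and g: "g \<in> D"
  shows "g [^] m \<in> Z"
proof -
  let ?D = "G\<lparr>carrier := D\<rparr>"
  interpret D: group ?D using D by (rule subgroup_imp_group)
  have sub: "subgroup Z ?D" using Z D by (simp add: subgroup_incl)
  have "Z \<lhd> ?D"
    using sub nor by (auto simp: D.normal_inv_iff m_inv_consistent[OF D])
  then interpret N: normal Z ?D .
  interpret Q: group "?D Mod Z" by (rule N.factorgroup_is_group)
  have cD: "order ?D = card D" by (simp add: order_def)
  have "card Z > 0" using fin Z(1) by (metis card_gt_0_iff empty_iff finite_subset subgroup.one_closed subgroup.subset)
  then have ord: "order (?D Mod Z) = m"
    using D.lagrange[OF sub] card by (simp add: cD FactGroup_def order_def)
  have "Z #>\<^bsub>?D\<^esub> g \<in> carrier (?D Mod Z)" using g by (auto simp: carrier_FactGroup)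
  then have "(Z #>\<^bsub>?D\<^esub> g) [^]\<^bsub>?D Mod Z\<^esub> m = \<one>\<^bsub>?D Mod Z\<^esub>"
    using Q.pow_order_eq_1 ord by blast
  then have "Z #>\<^bsub>?D\<^esub> (g [^]\<^bsub>?D\<^esub> m) = Z" using N.FactGroup_pow[of g m] g by simp
  moreover have "g [^]\<^bsub>?D\<^esub> m \<in> carrier ?D" using g by (intro D.nat_pow_closed) simp
  ultimately have "g [^]\<^bsub>?D\<^esub> m \<in> Z" using D.rcos_self sub by blast
  then show ?thesis by (simp flip: nat_pow_consistent)
qed

lemma mem_powers: "y \<in> powers x \<longleftrightarrow> (\<exists>k::nat. y = x [^] k)"
  by (auto simp: powers_def)

lemma self_in_powers: "x \<in> carrier G \<Longrightarrow> x \<in> powers x"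
  unfolding mem_powers by (metis nat_pow_eone)

lemma powers_eq_generate:
  assumes "finite (carrier G)" "x \<in> carrier G"
  shows "powers x = generate G {x}"
  using generate_pow_on_finite_carrier[OF assms] by (auto simp: powers_def)

lemma powers_subgroup:
  assumes "finite (carrier G)" "x \<in> carrier G"
  shows "subgroup (powers x) G"
  using generate_is_subgroup[of "{x}"] assms by (simp add: powers_eq_generate)

lemma powers_subset:
  assumes "subgroup H G" "x \<in> H"
  shows "powers x \<subseteq> H"
proof -
  have "x [^] (k::nat) \<in> H" for k
    by (induction k) (use assms in \<open>simp_all add: subgroup.one_closed subgroup.m_closed\<close>)
  then show ?thesis by (auto simp: powers_def)
qed

lemma card_powers:
  assumes "finite (carrier G)" "x \<in> carrier G"
  shows "card (powers x) = ord x"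
  using assms generate_pow_card by (simp add: powers_eq_generate)

lemma subgroup_finite:
  assumes "finite (carrier G)" "subgroup H G"
  shows "finite H" "0 < card H"
  using assms by (meson finite_subset subgroup.subset,
    metis card_gt_0_iff empty_iff finite_subset subgroup.one_closed subgroup.subset)

text \<open>A group of prime order has no proper nontrivial subgroup.\<close>
lemma powers_eq_if_prime:
  assumes fin: "finite (carrier G)" and x: "x \<in> carrier G" "prime (ord x)"
    and y: "y \<in> powers x" "y \<noteq> \<one>"
  shows "powers y = powers x"
proof -
  have sub: "subgroup (powers x) G" using fin x by (simp add: powers_subgroup)
  have yG: "y \<in> carrier G" using sub y(1) by (simp add: subgroup.mem_carrier)
  have "ord y dvd ord x" using ord_dvd_card[OF sub y(1)] by (simp add: card_powers fin x)
  then have "ord y = ord x" using x(2) y(2) yG by (metis ord_eq_1 prime_nat_iff)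
  then have "card (powers y) = card (powers x)" by (simp add: card_powers fin x yG)
  moreover have "powers y \<subseteq> powers x" using sub y(1) by (rule powers_subset)
  ultimately show ?thesis using subgroup_finite(1)[OF fin sub] by (metis card_subset_eq)
qed

lemma ord_in_powers_prime:
  assumes fin: "finite (carrier G)" and x: "x \<in> carrier G" "prime (ord x)"
    and y: "y \<in> powers x" "y \<noteq> \<one>"
  shows "ord y = ord x"
proof -
  have "y \<in> carrier G" using powers_subgroup[OF fin x(1)] y(1) by (simp add: subgroup.mem_carrier)
  then show ?thesis using powers_eq_if_prime[OF assms] by (metis card_powers fin x(1))
qed

lemma prime_generator:
  assumes "finite (carrier G)" "x \<in> carrier G" "prime (ord x)" "y \<in> powers x" "y \<noteq> \<one>"
  shows "\<exists>k::nat. x = y [^] k"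
  using powers_eq_if_prime[OF assms] self_in_powers[OF assms(2)] unfolding powers_def by blast

lemma centralizer_subgroup:
  assumes x: "x \<in> carrier G"
  shows "subgroup (centralizer x) G"
proof (rule subgroupI)
  show "centralizer x \<noteq> {}" using x by (auto simp: centralizer_def)
  show "inv g \<in> centralizer x" if "g \<in> centralizer x" for g
  proof -
    have g: "g \<in> carrier G" "g \<otimes> x = x \<otimes> g" using that by (auto simp: centralizer_def)
    have "inv g \<otimes> x = inv g \<otimes> (x \<otimes> g) \<otimes> inv g" using g(1) x by (simp add: m_assoc)
    also have "\<dots> = x \<otimes> inv g" using g x by (simp add: m_assoc inv_mult_cancel flip: g(2))
    finally show ?thesis using g(1) by (simp add: centralizer_def)
  qed
  show "g \<otimes> h \<in> centralizer x" if "g \<in> centralizer x" "h \<in> centralizer x" for g h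
    using that x unfolding centralizer_def by clarsimp (metis m_assoc)
qed (auto simp: centralizer_def)

lemma powers_le_centralizer:
  assumes "x \<in> carrier G"
  shows "powers x \<subseteq> centralizer x"
  using assms by (intro powers_subset centralizer_subgroup) (auto simp: centralizer_def)

lemma centralizer_commute_powers:
  assumes "g \<in> centralizer x" "x \<in> carrier G" "y \<in> powers x"
  shows "g \<otimes> y = y \<otimes> g"
  using assms by (auto simp: centralizer_def mem_powers group_commutes_pow)

lemma normalizer_conj:
  assumes "g \<in> normalizer x" "x \<in> carrier G" "finite (carrier G)" "y \<in> powers x"
  shows "g \<otimes> y \<otimes> inv g \<in> powers x"
proof -
  have g: "g \<in> carrier G" "g \<otimes> x \<otimes> inv g \<in> powers x" using assms(1) by (auto simp: normalizer_def)
  obtain k :: nat where k: "y = x [^] k" using assms(4) by (auto simp: mem_powers)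
  have "(g \<otimes> x \<otimes> inv g) [^] k \<in> powers x"
    using powers_subset[OF powers_subgroup[OF assms(3,2)] g(2)] by (auto simp: powers_def)
  then show ?thesis using g(1) assms(2) k by (simp add: conj_pow)
qed

lemma normalizer_subgroup:
  assumes fin: "finite (carrier G)" and x: "x \<in> carrier G"
  shows "subgroup (normalizer x) G"
proof (rule subgroupI)
  show "normalizer x \<noteq> {}" using x self_in_powers[OF x] by (auto simp: normalizer_def m_assoc intro!: exI[of _ x])
  have pow: "powers x \<subseteq> carrier G" "finite (powers x)"
    using powers_subgroup[OF fin x] subgroup.subset subgroup_finite(1)[OF fin] by auto
  show "inv g \<in> normalizer x" if g: "g \<in> normalizer x" for g
  proof -
    have gG: "g \<in> carrier G" using g by (simp add: normalizer_def)
    have "(\<lambda>y. g \<otimes> y \<otimes> inv g) ` powers x \<subseteq> powers x" using normalizer_conj[OF g x fin] by blast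
    moreover have "inj_on (\<lambda>y. g \<otimes> y \<otimes> inv g) (powers x)"
      using gG pow(1) by (intro inj_onI) (meson conj_eq_iff subsetD)
    ultimately have "(\<lambda>y. g \<otimes> y \<otimes> inv g) ` powers x = powers x"
      using pow(2) by (simp add: endo_inj_surj)
    then obtain y where y: "y \<in> powers x" "x = g \<otimes> y \<otimes> inv g" using self_in_powers[OF x] by blast
    then have "inv g \<otimes> x \<otimes> g = y" using conj_inv_cancel gG pow(1) by blast
    then show ?thesis using y gG by (simp add: normalizer_def)
  qed
  show "g \<otimes> h \<in> normalizer x" if g: "g \<in> normalizer x" and h: "h \<in> normalizer x" for g h
  proof -
    have "g \<otimes> (h \<otimes> x \<otimes> inv h) \<otimes> inv g \<in> powers x"
      using normalizer_conj[OF g x fin] h by (simp add: normalizer_def)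
    then show ?thesis using g h x by (simp add: normalizer_def conj_conj)
  qed
qed (auto simp: normalizer_def)

lemma centralizer_le_normalizer:
  assumes "x \<in> carrier G"
  shows "centralizer x \<subseteq> normalizer x"
  using assms self_in_powers by (auto simp: centralizer_def normalizer_def m_assoc)

text \<open>The powers of a nontrivial element \<open>y\<close> of the subgroup \<open>powers x\<close> of prime order already make up the
  whole of it, so it suffices to conjugate \<open>y\<close>.\<close>
lemma normalizerI_prime:
  assumes fin: "finite (carrier G)" and x: "x \<in> carrier G" "prime (ord x)" and g: "g \<in> carrier G"
    and y: "y \<in> powers x" "y \<noteq> \<one>" "g \<otimes> y \<otimes> inv g \<in> powers x"
  shows "g \<in> normalizer x"
proof -
  have yG: "y \<in> carrier G" using powers_subgroup[OF fin x(1)] y(1) by (simp add: subgroup.mem_carrier)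
  obtain k :: nat where k: "x = y [^] k"
    using powers_eq_if_prime[OF fin x y(1,2)] self_in_powers[OF x(1)] unfolding powers_def by blast
  have "(g \<otimes> y \<otimes> inv g) [^] k \<in> powers x"
    using powers_subset[OF powers_subgroup[OF fin x(1)] y(3)] by (auto simp: powers_def)
  then show ?thesis using g yG k by (simp add: normalizer_def conj_pow)
qed

text \<open>A normal Sylow \<open>p\<close>-subgroup of order \<open>p\<close> contains all elements of order \<open>p\<close>: for such \<open>y\<close> the power
  \<open>y [^] m\<close> lies in \<open>powers x\<close> and still generates \<open>powers y\<close>, as \<open>p\<close> does not divide \<open>m\<close>.\<close>
lemma p_element_in_normal:
  assumes fin: "finite (carrier G)" and D: "subgroup D G" and x: "x \<in> carrier G" "powers x \<subseteq> D"
    and DN: "D \<subseteq> normalizer x" and p: "prime p" "ord x = p"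
    and card: "card D = p * m" "\<not> p dvd m" and y: "y \<in> D" "y [^] p = \<one>"
  shows "y \<in> powers x"
proof (cases "y = \<one>")
  case True
  then show ?thesis using powers_subgroup[OF fin x(1)] by (simp add: subgroup.one_closed)
next
  case False
  have yG: "y \<in> carrier G" using D y(1) by (simp add: subgroup.mem_carrier)
  have ord: "ord y = p" using ord_prime_if yG p(1) y(2) False by blast
  have "y [^] m \<in> powers x"
    using pow_index_in_normal[OF fin D powers_subgroup[OF fin x(1)] x(2)] normalizer_conj[OF _ x(1) fin]
      DN card y(1) by (simp add: card_powers fin x p subset_iff)
  moreover have "y [^] m \<noteq> \<one>" using yG ord card(2) by (simp add: pow_eq_id)
  ultimately have "powers (y [^] m) = powers x"
    using powers_eq_if_prime fin x(1) p by metis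
  moreover have "powers (y [^] m) = powers y"
    using powers_eq_if_prime[OF fin yG, of "y [^] m"] ord p \<open>y [^] m \<noteq> \<one>\<close> by (auto simp: mem_powers)
  ultimately show ?thesis using self_in_powers[OF yG] by simp
qed

lemma central_pow_in_powers:
  assumes fin: "finite (carrier G)" and D: "subgroup D G" "D \<subseteq> centralizer x"
    and x: "x \<in> D" "ord x = p" and card: "card D = p * m" and g: "g \<in> D"
  shows "g [^] m \<in> powers x"
proof -
  have xG: "x \<in> carrier G" using D x by (simp add: subgroup.mem_carrier)
  show ?thesis
    using pow_index_in_normal[OF fin D(1) powers_subgroup[OF fin xG] powers_subset[OF D(1) x(1)]]
      normalizer_conj[OF _ xG fin] centralizer_le_normalizer[OF xG] D card g
    by (simp add: card_powers fin xG x subset_iff)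
qed

text \<open>With \<open>x\<close> central of prime order \<open>p\<close> in \<open>D\<close> of order \<open>p * m\<close>, these are the elements whose order is
  neither prime to \<open>p\<close> nor a power of \<open>p\<close>.\<close>
definition mixed :: "'a set \<Rightarrow> 'a \<Rightarrow> nat \<Rightarrow> 'a set"
  where "mixed D x m = {g \<in> D. g [^] m \<noteq> \<one> \<and> g \<notin> powers x}"

lemma mixed_not_prime:
  assumes fin: "finite (carrier G)" and D: "subgroup D G" "D \<subseteq> centralizer x"
    and x: "x \<in> D" "prime p" "ord x = p" and card: "card D = p * m" "\<not> p dvd m" and g: "g \<in> mixed D x m"
  shows "\<not> prime (ord g)" "g \<noteq> \<one>"
proof -
  have xG: "x \<in> carrier G" using D x by (simp add: subgroup.mem_carrier)
  have gD: "g \<in> D" and gG: "g \<in> carrier G" using D g by (auto simp: mixed_def subgroup.mem_carrier)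
  show "g \<noteq> \<one>" using g by (auto simp: mixed_def)
  show "\<not> prime (ord g)"
  proof
    assume pr: "prime (ord g)"
    have "ord g dvd p * m" using ord_dvd_card[OF D(1) gD] card by simp
    moreover have "\<not> ord g dvd m" using g gG by (simp add: mixed_def flip: pow_eq_id)
    ultimately have "ord g = p" using pr x(2) by (metis prime_dvd_multD primes_dvd_imp_eq)
    then have "g [^] p = \<one>" using gG by auto
    then have "g \<in> powers x"
      using p_element_in_normal[OF fin D(1) xG powers_subset[OF D(1) x(1)] _ x(2,3) card gD]
        D(2) centralizer_le_normalizer[OF xG] by blast
    then show False using g by (simp add: mixed_def)
  qed
qed

text \<open>Products of an element \<open>k\<close> of the set with an element \<open>z\<close> of \<open>powers x\<close> are pairwise different, because
  \<open>z\<close> can be recovered from \<open>(k \<otimes> z) [^] m = z [^] m\<close>. Hence there are at most \<open>card D div p\<close> of them.\<close>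
lemma card_roots_le:
  assumes fin: "finite (carrier G)" and D: "subgroup D G" "D \<subseteq> centralizer x"
    and x: "x \<in> D" "prime p" "ord x = p" and card: "card D = p * m" "\<not> p dvd m"
  shows "card {g \<in> D. g [^] m = \<one>} \<le> m"
proof -
  let ?K = "{g \<in> D. g [^] m = \<one>}"
  have xG: "x \<in> carrier G" using D x by (simp add: subgroup.mem_carrier)
  note Z = powers_subgroup[OF fin xG] and ZD = powers_subset[OF D(1) x(1)]
  have DG: "D \<subseteq> carrier G" using D(1) by (simp add: subgroup.subset)
  have inj: "inj_on (\<lambda>(k, z). k \<otimes> z) (?K \<times> powers x)"
  proof (rule inj_onI, clarify)
    fix k z k' z'
    assume k: "k \<in> D" "k' \<in> D" "k [^] m = \<one>" "k' [^] m = \<one>" and z: "z \<in> powers x" "z' \<in> powers x"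
      and eq: "k \<otimes> z = k' \<otimes> z'"
    have G: "k \<in> carrier G" "k' \<in> carrier G" "z \<in> carrier G" "z' \<in> carrier G" using k z DG ZD by auto
    have com: "k \<otimes> z = z \<otimes> k" "k' \<otimes> z' = z' \<otimes> k'"
      using k z D(2) centralizer_commute_powers xG by blast+
    have "(k \<otimes> z) [^] m = z [^] m" "(k' \<otimes> z') [^] m = z' [^] m"
      using pow_mult_distrib[OF com(1) G(1,3)] pow_mult_distrib[OF com(2) G(2,4)] k G by simp_all
    then have zm: "z [^] m = z' [^] m" using eq by simp
    obtain i j :: nat where ij: "z = x [^] i" "z' = x [^] j" using z by (auto simp: mem_powers)
    have "x [^] int (i * m) = x [^] int (j * m)"
      using zm xG unfolding int_pow_int by (simp add: ij nat_pow_pow)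
    then have "int p dvd int (j * m) - int (i * m)"
      using xG by (simp add: int_pow_eq x del: of_nat_mult)
    then have "int p dvd (int j - int i) * int m" by (simp add: left_diff_distrib)
    then have "int p dvd int j - int i" using card(2) x(2)
      by (metis int_dvd_int_iff prime_dvd_mult_iff prime_nat_int_transfer)
    then have "z = z'" using xG by (simp add: ij int_pow_eq x flip: int_pow_int)
    then show "k = k' \<and> z = z'" using eq G by simp
  qed
  have "(\<lambda>(k, z). k \<otimes> z) ` (?K \<times> powers x) \<subseteq> D"
    using ZD D(1) by (auto intro!: subgroup.m_closed)
  then have "card (?K \<times> powers x) \<le> card D"
    using card_inj_on_le[OF inj] subgroup_finite(1)[OF fin D(1)] by blast
  then have "card ?K * p \<le> m * p" by (simp add: card_cartesian_product card_powers fin xG x card mult.commute)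
  then show ?thesis using x(2) prime_gt_0_nat by auto
qed

lemma card_mixed:
  assumes fin: "finite (carrier G)" and D: "subgroup D G" "D \<subseteq> centralizer x"
    and x: "x \<in> D" "prime p" "ord x = p" and card: "card D = p * m" "\<not> p dvd m"
  shows "(p - 1) * (m - 1) \<le> card (mixed D x m)"
proof -
  let ?K = "{g \<in> D. g [^] m = \<one>}"
  have xG: "x \<in> carrier G" using D x by (simp add: subgroup.mem_carrier)
  note Z = powers_subgroup[OF fin xG] and ZD = powers_subset[OF D(1) x(1)]
  have finD: "finite D" using subgroup_finite(1)[OF fin D(1)] .
  have 1: "\<one> \<in> ?K \<inter> powers x" using D Z by (simp add: subgroup.one_closed)
  have eq: "mixed D x m = D - (?K \<union> powers x)" by (auto simp: mixed_def)
  have "card (?K \<union> powers x) + card (?K \<inter> powers x) = card ?K + card (powers x)"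
    using finD ZD by (subst card_Un_Int) (auto intro: finite_subset)
  moreover have "card (?K \<inter> powers x) \<ge> 1" using 1 finD by (metis (no_types, lifting) One_nat_def Suc_leI card_gt_0_iff empty_iff finite_Int finite_subset mem_Collect_eq subsetI)
  moreover have "card ?K \<le> m" using card_roots_le[OF assms] .
  ultimately have "card (?K \<union> powers x) + 1 \<le> m + p" by (simp add: card_powers fin xG x)
  moreover have "card (mixed D x m) = p * m - card (?K \<union> powers x)"
    unfolding eq using finD ZD by (subst card_Diff_subset) (auto intro: finite_subset simp: card)
  ultimately have "p * m + 1 \<le> card (mixed D x m) + m + p" by linarith
  moreover have "p \<ge> 1" using x(2) by (simp add: prime_gt_0_nat Suc_leI)
  moreover have "m \<ge> 1" using card(2) by (metis One_nat_def Suc_leI dvd_0_right gr0I)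
  moreover from \<open>p \<ge> 1\<close> \<open>m \<ge> 1\<close> have "(p - 1) * (m - 1) + m + p = p * m + 1"
    by (cases p; cases m) simp_all
  ultimately show ?thesis by linarith
qed

end

section \<open>Elements of composite order and conjugates\<close>

lemma Omega_1 [simp]: "Omega (Suc 0) = 0" "Omega 1 = 0" by (simp_all add: Omega_def)

lemma Omega_prime: "prime p \<Longrightarrow> Omega p = 1"
  by (simp add: Omega_def prime_factorization_prime)

lemma Omega_mult: "a \<noteq> 0 \<Longrightarrow> b \<noteq> 0 \<Longrightarrow> Omega (a * b) = Omega a + Omega b"
  by (simp add: Omega_def prime_factorization_mult)

lemma Omega_pos: "1 < n \<Longrightarrow> 1 \<le> Omega n"
  by (auto simp: Omega_def Suc_le_eq nonempty_has_size[symmetric] prime_factorization_empty_iff)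

lemma Omega_composite: 
  assumes "1 < n" "\<not> prime n"
  shows "2 \<le> Omega n"
proof -
  obtain p where p: "prime p" "p dvd n" using assms(1) prime_factor_nat by (metis nat_neq_iff)
  then obtain m where m: "n = p * m" by (auto simp: dvd_def)
  have "m \<noteq> 0" "m \<noteq> 1" using m assms p by (auto intro: ccontr)
  then show ?thesis using Omega_mult[of p m] Omega_pos[of m] Omega_prime[OF p(1)] p(1) m by (auto simp: prime_gt_0_nat)
qed

lemma Omega_prod:
  assumes "finite A" "\<And>x. x \<in> A \<Longrightarrow> f x \<noteq> 0"
  shows "Omega (\<Prod>x\<in>A. f x) = (\<Sum>x\<in>A. Omega (f x))"
  using assms by (induction A rule: finite_induct) (simp_all add: Omega_mult)

context group
begin

lemma Omega_rho_eq_sum: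
  assumes "finite (carrier G)"
  shows "Omega_rho G = (\<Sum>g\<in>carrier G. Omega (ord g))"
  unfolding Omega_rho_def rho_def using assms ord_ge_1[OF assms] by (intro Omega_prod) (auto simp: Suc_le_eq)

lemma Omega_rho_ge:
  assumes fin: "finite (carrier G)" and E: "E \<subseteq> carrier G"
    and np: "\<And>g. g \<in> E \<Longrightarrow> g \<noteq> \<one> \<and> \<not> prime (ord g)"
  shows "order G + card E \<le> Omega_rho G + 1"
proof -
  have gt1: "1 < ord g" if "g \<in> carrier G" "g \<noteq> \<one>" for g
    using ord_ge_1[OF fin that(1)] ord_eq_1[OF that(1)] that(2) by linarith
  have finE: "finite E" using fin E finite_subset by blast
  have "(\<Sum>g\<in>carrier G. if g \<in> E then 1 else 0) = card E"
    using fin E by (simp add: sum.If_cases Int_absorb1)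
  then have "order G + card E = (\<Sum>g\<in>carrier G. 1 + (if g \<in> E then 1 else 0))"
    unfolding sum.distrib by (simp add: order_def)
  also have "\<dots> = 1 + (\<Sum>g\<in>carrier G - {\<one>}. 1 + (if g \<in> E then 1 else 0))"
    using fin np by (subst sum.remove[of _ \<one>]) auto
  also have "(\<Sum>g\<in>carrier G - {\<one>}. 1 + (if g \<in> E then 1 else 0)) \<le> (\<Sum>g\<in>carrier G - {\<one>}. Omega (ord g))"
  proof (rule sum_mono)
    fix g assume g: "g \<in> carrier G - {\<one>}"
    have "1 < ord g" using gt1 g by blast
    then show "1 + (if g \<in> E then 1 else 0) \<le> Omega (ord g)"
      using np[of g] Omega_pos[of "ord g"] Omega_composite[of "ord g"] by (cases "g \<in> E") simp_all
  qed
  also have "\<dots> = Omega_rho G"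
    unfolding Omega_rho_eq_sum[OF fin] using fin by (subst sum.remove[of _ \<one>]) auto
  finally show ?thesis by simp
qed

definition conjugates :: "'a set \<Rightarrow> 'a set"
  where "conjugates Y = (\<lambda>(g, y). g \<otimes> y \<otimes> inv g) ` (carrier G \<times> Y)"

text \<open>The map \<open>(g, y) \<mapsto> g \<otimes> y \<otimes> inv g\<close> has fibres of size at most \<open>card S\<close>: two pairs with the same
  image differ by an element that conjugates \<open>Y\<close> into itself at some point, and the first component determines
  the second one.\<close>
lemma card_conjugates:
  assumes fin: "finite (carrier G)" and YS: "Y \<subseteq> carrier G" "S \<subseteq> carrier G"
    and TI: "\<And>g y. g \<in> carrier G \<Longrightarrow> y \<in> Y \<Longrightarrow> g \<otimes> y \<otimes> inv g \<in> Y \<Longrightarrow> g \<in> S"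
  shows "order G * card Y \<le> card (conjugates Y) * card S"
proof -
  let ?A = "carrier G \<times> Y" and ?f = "\<lambda>(g, y). g \<otimes> y \<otimes> inv g"
  have finA: "finite ?A" and finS: "finite S" using fin YS by (auto intro: finite_subset)
  have fib: "card {a \<in> ?A. ?f a = z} \<le> card S" if z: "z \<in> ?f ` ?A" for z
  proof -
    obtain h u where hu: "h \<in> carrier G" "u \<in> Y" "z = h \<otimes> u \<otimes> inv h" using z by auto
    let ?F = "{a \<in> ?A. ?f a = z}"
    have uG: "u \<in> carrier G" using hu YS by auto
    have *: "inv h \<otimes> g \<in> S" if "g \<in> carrier G" "y \<in> Y" "g \<otimes> y \<otimes> inv g = z" for g y
    proof (rule TI[of _ y])
      have "(inv h \<otimes> g) \<otimes> y \<otimes> inv (inv h \<otimes> g) = inv h \<otimes> (g \<otimes> y \<otimes> inv g) \<otimes> inv (inv h)"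
        using conj_conj[of "inv h" g y] that hu YS by auto
      also have "\<dots> = u" using that(3) hu uG conj_inv_cancel[of h u] by simp
      finally show "(inv h \<otimes> g) \<otimes> y \<otimes> inv (inv h \<otimes> g) \<in> Y" using hu by simp
    qed (use that hu in auto)
    have "inj_on (\<lambda>(g, y). inv h \<otimes> g) ?F"
    proof (rule inj_onI, clarify)
      fix g y g' y'
      assume a: "g \<in> carrier G" "y \<in> Y" "g' \<in> carrier G" "y' \<in> Y" "inv h \<otimes> g = inv h \<otimes> g'"
        "z = g \<otimes> y \<otimes> inv g" "g' \<otimes> y' \<otimes> inv g' = g \<otimes> y \<otimes> inv g"
      then have "g = g'" using hu by simp
      then show "g = g' \<and> y = y'" using a YS conj_eq_iff[of g y y'] by auto
    qed
    moreover have "(\<lambda>(g, y). inv h \<otimes> g) ` ?F \<subseteq> S" using * by auto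
    ultimately show ?thesis using finS card_inj_on_le by blast
  qed
  have "card ?A = (\<Sum>z\<in>?f ` ?A. card {a \<in> ?A. ?f a = z})"
    using sum.image_gen[OF finA, of "\<lambda>_. 1 :: nat" ?f] by simp
  also have "\<dots> \<le> (\<Sum>z\<in>?f ` ?A. card S)" using fib by (rule sum_mono)
  finally show ?thesis by (simp add: card_cartesian_product order_def conjugates_def)
qed

lemma conjugates_subset: "Y \<subseteq> carrier G \<Longrightarrow> conjugates Y \<subseteq> carrier G"
  by (auto simp: conjugates_def)

lemma ord_conjugates:
  assumes "Y \<subseteq> carrier G" "z \<in> conjugates Y"
  shows "\<exists>y\<in>Y. ord z = ord y"
proof -
  obtain g y where "g \<in> carrier G" "y \<in> Y" "z = g \<otimes> y \<otimes> inv g"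
    using assms(2) by (auto simp: conjugates_def)
  then show ?thesis using assms(1) ord_conj by blast
qed

lemma card_normalizer_factor:
  assumes fin: "finite (carrier G)" and x: "x \<in> carrier G" "ord x = p" and p: "prime p"
    and order: "order G = p * k" "\<not> p dvd k"
  shows "\<exists>m. card (normalizer x) = p * m \<and> m dvd k \<and> \<not> p dvd m"
proof -
  have sub: "powers x \<subseteq> normalizer x" using powers_le_centralizer centralizer_le_normalizer x by blast
  have "p dvd card (normalizer x)"
    using subgroup_card_dvd[OF powers_subgroup[OF fin x(1)] normalizer_subgroup[OF fin x(1)] sub] card_powers[OF fin x(1)] x by simp
  then obtain m where m: "card (normalizer x) = p * m" by (auto simp: dvd_def)
  have "card (normalizer x) dvd p * k"
    using subgroup_card_dvd[OF normalizer_subgroup[OF fin x(1)] subgroup_self] order by (simp add: order_def normalizer_def)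
  then have "m dvd k" using p m by (simp add: prime_gt_0_nat)
  then show ?thesis using m order by (metis dvd_trans)
qed

lemma normalizer_pow_one_in_powers:
  assumes fin: "finite (carrier G)" and x: "x \<in> carrier G" "ord x = p" and p: "prime p"
    and order: "order G = p * k" "\<not> p dvd k" and y: "y \<in> normalizer x" "y [^] p = \<one>"
  shows "y \<in> powers x"
  using card_normalizer_factor[OF fin x p order] p_element_in_normal[OF fin normalizer_subgroup[OF fin x(1)] x(1) _ subset_refl p x(2) _ _ y]
    powers_le_centralizer[OF x(1)] centralizer_le_normalizer[OF x(1)] by blast

text \<open>If \<open>y \<otimes> g \<otimes> n\<close> had two representations, then \<open>inv g\<close> would conjugate a nontrivial power of \<open>x\<close> into
  the normalizer; being of order \<open>p\<close>, the conjugate would lie in \<open>powers x\<close>, and \<open>g\<close> would normalize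
  \<open>powers x\<close>.\<close>
lemma double_coset_injective:
  assumes fin: "finite (carrier G)" and x: "x \<in> carrier G" "ord x = p" and p: "prime p"
    and order: "order G = p * k" "\<not> p dvd k" and g: "g \<in> carrier G" "g \<notin> normalizer x"
  shows "inj_on (\<lambda>(y, n). y \<otimes> g \<otimes> n) (powers x \<times> normalizer x)"
proof (rule inj_onI, clarify)
  fix y n y' n'
  assume a: "y \<in> powers x" "y' \<in> powers x" "n \<in> normalizer x" "n' \<in> normalizer x"
    and eq: "y \<otimes> g \<otimes> n = y' \<otimes> g \<otimes> n'"
  note N = normalizer_subgroup[OF fin x(1)] and P = powers_subgroup[OF fin x(1)]
  have G: "y \<in> carrier G" "y' \<in> carrier G" "n \<in> carrier G" "n' \<in> carrier G"
    using a N P by (simp_all add: subgroup.mem_carrier)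
  define z where "z = inv y' \<otimes> y"
  have zP: "z \<in> powers x" using a P by (simp add: z_def subgroup.m_closed subgroup.m_inv_closed)
  then have zG: "z \<in> carrier G" using P by (simp add: subgroup.mem_carrier)
  have "z \<otimes> g \<otimes> n = inv y' \<otimes> (y \<otimes> g \<otimes> n)" using G g by (simp add: z_def m_assoc)
  also have "\<dots> = g \<otimes> n'" unfolding eq using G g by (simp add: m_assoc inv_mult_cancel)
  finally have *: "z \<otimes> g \<otimes> n = g \<otimes> n'" .
  have "z \<otimes> g = g \<otimes> n' \<otimes> inv n" using G g zG by (simp add: m_assoc inv_mult_cancel flip: *)
  then have "inv g \<otimes> z \<otimes> inv (inv g) = n' \<otimes> inv n" using G g zG by (simp add: m_assoc inv_mult_cancel)
  then have 1: "inv g \<otimes> z \<otimes> inv (inv g) \<in> normalizer x" using a N by (simp add: subgroup.m_closed subgroup.m_inv_closed)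
  have "z [^] p = \<one>" using zP zG ord_in_powers_prime[OF fin x(1)] x p by (cases "z = \<one>") (auto simp: pow_eq_id)
  then have "(inv g \<otimes> z \<otimes> inv (inv g)) [^] p = \<one>" using g zG conj_pow[of "inv g" z p] by simp
  then have 2: "inv g \<otimes> z \<otimes> inv (inv g) \<in> powers x"
    using normalizer_pow_one_in_powers[OF fin x p order 1] by blast
  have "z = \<one>"
  proof (rule ccontr)
    assume "z \<noteq> \<one>"
    then have "inv g \<in> normalizer x" using normalizerI_prime[OF fin x(1) _ _ zP _ 2] x p g by simp
    then show False using g N subgroup.m_inv_closed by fastforce
  qed
  moreover have "y = y' \<otimes> z" using G by (simp add: z_def inv_mult_cancel)
  ultimately have "y = y'" using G by simp
  then show "y = y' \<and> n = n'" using eq G g by simp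
qed

lemma double_coset_outside:
  assumes fin: "finite (carrier G)" and x: "x \<in> carrier G"
    and g: "g \<in> carrier G - normalizer x" and a: "y \<in> powers x" "n \<in> normalizer x"
  shows "y \<otimes> g \<otimes> n \<in> carrier G - normalizer x"
proof -
  note N = normalizer_subgroup[OF fin x(1)]
  have y: "y \<in> normalizer x" using powers_le_centralizer centralizer_le_normalizer x a(1) by blast
  have G: "y \<in> carrier G" "n \<in> carrier G" using a(2) y N by (simp_all add: subgroup.mem_carrier)
  have "g \<in> normalizer x" if "y \<otimes> g \<otimes> n \<in> normalizer x"
  proof -
    have "inv y \<otimes> (y \<otimes> g \<otimes> n) \<otimes> inv n \<in> normalizer x"
      using that y a(2) N by (simp add: subgroup.m_closed subgroup.m_inv_closed)
    moreover have "inv y \<otimes> (y \<otimes> g \<otimes> n) \<otimes> inv n = g" using g G by (simp add: m_assoc inv_mult_cancel)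
    ultimately show ?thesis by simp
  qed
  then show ?thesis using g G by auto
qed

text \<open>The complement of the normalizer is a disjoint union of double cosets, all of the same size. This stands in for
  the congruence of the Sylow theorems modulo \<open>p\<close>.\<close>
lemma double_coset_dvd:
  assumes fin: "finite (carrier G)" and x: "x \<in> carrier G" "ord x = p" and p: "prime p"
    and order: "order G = p * k" "\<not> p dvd k"
  shows "p * card (normalizer x) dvd order G - card (normalizer x)"
proof -
  let ?A = "carrier G - normalizer x"
  define r where "r = {(g, h). g \<in> ?A \<and> (\<exists>y\<in>powers x. \<exists>n\<in>normalizer x. h = y \<otimes> g \<otimes> n)}"
  note N = normalizer_subgroup[OF fin x(1)] and P = powers_subgroup[OF fin x(1)]
  have equiv: "equiv ?A r"
  proof (rule equivI)
    show "r \<subseteq> ?A \<times> ?A" using double_coset_outside[OF fin x(1)] by (auto simp: r_def)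
    show "refl_on ?A r"
    proof (rule refl_onI)
      fix g assume g: "g \<in> ?A"
      have "\<one> \<in> powers x" "\<one> \<in> normalizer x" "g = \<one> \<otimes> g \<otimes> \<one>"
        using g P N by (simp_all add: subgroup.one_closed)
      then show "(g, g) \<in> r" unfolding r_def using g by blast
    qed
    show "sym r"
    proof (rule symI)
      fix g h assume gh: "(g, h) \<in> r"
      then obtain y n where yn: "g \<in> ?A" "y \<in> powers x" "n \<in> normalizer x" "h = y \<otimes> g \<otimes> n" by (auto simp: r_def)
      then have G: "y \<in> carrier G" "n \<in> carrier G" "g \<in> carrier G" using N P by (auto simp: subgroup.mem_carrier)
      have "g = inv y \<otimes> h \<otimes> inv n" using yn(4) G by (simp add: m_assoc inv_mult_cancel)
      moreover have "h \<in> ?A" using double_coset_outside[OF fin x(1)] yn by auto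
      moreover have "inv y \<in> powers x" "inv n \<in> normalizer x"
        using yn N P by (simp_all add: subgroup.m_inv_closed)
      ultimately show "(h, g) \<in> r" unfolding r_def by blast
    qed
    show "trans r"
    proof (rule transI)
      fix g h u assume "(g, h) \<in> r" "(h, u) \<in> r"
      then obtain y n y' n' where yn: "g \<in> ?A" "y \<in> powers x" "n \<in> normalizer x" "h = y \<otimes> g \<otimes> n"
          "y' \<in> powers x" "n' \<in> normalizer x" "u = y' \<otimes> h \<otimes> n'" by (auto simp: r_def)
      then have G: "y \<in> carrier G" "n \<in> carrier G" "g \<in> carrier G" "y' \<in> carrier G" "n' \<in> carrier G"
        using N P by (auto simp: subgroup.mem_carrier)
      have "u = (y' \<otimes> y) \<otimes> g \<otimes> (n \<otimes> n')" using yn(4,7) G by (simp add: m_assoc)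
      moreover have "y' \<otimes> y \<in> powers x" "n \<otimes> n' \<in> normalizer x"
        using yn N P by (simp_all add: subgroup.m_closed)
      ultimately show "(g, u) \<in> r" using yn(1) unfolding r_def by blast
    qed
  qed
  have classes: "p * card (normalizer x) dvd card X" if "X \<in> ?A // r" for X
  proof -
    obtain g where g: "g \<in> ?A" "X = r `` {g}" using \<open>X \<in> ?A // r\<close> by (auto elim: quotientE)
    then have "X = (\<lambda>(y, n). y \<otimes> g \<otimes> n) ` (powers x \<times> normalizer x)" by (auto simp: r_def)
    then have "card X = p * card (normalizer x)"
      using double_coset_injective[OF fin x p order, of g] g
      by (simp add: card_image card_cartesian_product card_powers fin x)
    then show ?thesis by simp
  qed
  have "p * card (normalizer x) dvd card ?A"
    using equiv_imp_dvd_card[OF _ equiv classes] fin by simp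
  then show ?thesis using fin N by (simp add: card_Diff_subset subgroup_finite subgroup.subset order_def)
qed

end

section \<open>The field with 13 elements\<close>

lemma prime3: "prime (3::nat)" by (simp add: prime_nat_numeral_eq)

locale field13 =
  fixes ty :: "'f::field itself"
  assumes card13: "CARD('f) = 13"
begin

lemma finite_UNIV13 [simp]: "finite (UNIV :: 'f set)"
  using card13 by (metis card.infinite zero_neq_numeral)

lemma finite_set13 [simp]: "finite (A :: 'f set)"
  using finite_UNIV13 by (rule rev_finite_subset) simp

lemma CHAR13: "CHAR('f) = 13"
proof -
  have "CHAR('f) dvd 13" using CHAR_dvd_CARD[where 'a='f] card13 by simp
  moreover have "prime (13::nat)" by (simp add: prime_nat_numeral_eq)
  ultimately show ?thesis using CHAR_not_1[where 'a='f] prime_nat_iff[of 13] by auto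
qed

lemma of_nat_eq13: "(of_nat i :: 'f) = of_nat j \<longleftrightarrow> i mod 13 = j mod 13"
  using of_nat_eq_iff_cong_CHAR[of i j, where 'a='f] by (simp add: CHAR13 cong_def)

lemma numeral_eq13:
  "(numeral m :: 'f) = numeral n \<longleftrightarrow> (numeral m :: nat) mod 13 = numeral n mod 13"
  "(numeral m :: 'f) = 1 \<longleftrightarrow> (numeral m :: nat) mod 13 = 1"
  "(1 :: 'f) = numeral m \<longleftrightarrow> (numeral m :: nat) mod 13 = 1"
  "(numeral m :: 'f) = 0 \<longleftrightarrow> (numeral m :: nat) mod 13 = 0"
  "(0 :: 'f) = numeral m \<longleftrightarrow> (numeral m :: nat) mod 13 = 0"
  using of_nat_eq13[of "numeral m" "numeral n"] of_nat_eq13[of "numeral m" 1] of_nat_eq13[of "numeral m" 0]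
  by auto

lemma UNIV13: "(UNIV :: 'f set) = of_nat ` {..<13}"
proof -
  have "inj_on (of_nat :: nat \<Rightarrow> 'f) {..<13}" by (auto intro!: inj_onI simp: of_nat_eq13)
  then have "card ((of_nat :: nat \<Rightarrow> 'f) ` {..<13}) = 13" by (simp add: card_image)
  then show ?thesis using card13 card_subset_eq[OF finite_UNIV13] by (metis subset_UNIV)
qed

lemma cases13: "(b :: 'f) \<in> {0,1,2,3,4,5,6,7,8,9,10,11,12}"
proof -
  have "b \<in> of_nat ` {..<13}" using UNIV13 by blast
  then obtain k where "k < 13" "b = of_nat k" by auto
  moreover have "k \<in> {0,1,2,3,4,5,6,7,8,9,10,11,12}" using \<open>k < 13\<close> by (simp; presburger)
  ultimately show ?thesis by auto
qed

text \<open>The nonzero squares, which are also the elements whose multiplicative order divides 6.\<close>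
definition Sq :: "'f set" where "Sq = {1,3,4,9,10,12}"

lemma card_Sq: "card Sq = 6"
  by (simp add: Sq_def numeral_eq13)

lemma pow6_iff: "(b :: 'f) ^ 6 = 1 \<longleftrightarrow> b \<in> Sq"
  using cases13[of b] by (auto simp: Sq_def numeral_eq13)

lemma pow7: "(b :: 'f) ^ 7 = 1 \<Longrightarrow> b = 1"
  using cases13[of b] by (auto simp: numeral_eq13)

text \<open>Multiplication by \<open>a\<close> permutes \<open>I\<close>, so the product of all elements of \<open>I\<close> does not change when it is
  multiplied by \<open>a ^ card I\<close>.\<close>
lemma closed_pow_card:
  fixes I :: "'f set"
  assumes "0 \<notin> I" "\<And>a b. a \<in> I \<Longrightarrow> b \<in> I \<Longrightarrow> a * b \<in> I" "a \<in> I"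
  shows "a ^ card I = 1"
proof -
  have "a \<noteq> 0" using assms by blast
  then have inj: "inj_on ((*) a) I" by (auto intro: inj_onI)
  have "(*) a ` I = I" using assms(2,3) inj by (intro endo_inj_surj) auto
  then have "\<Prod>I = (\<Prod>b\<in>I. a * b)" using prod.reindex[OF inj, of id] by (simp add: comp_def)
  also have "\<dots> = a ^ card I * \<Prod>I" by (simp add: prod.distrib)
  finally show ?thesis using assms(1) by (auto simp: prod_zero_iff)
qed

lemma closed_card6:
  fixes I :: "'f set"
  assumes "0 \<notin> I" "\<And>a b. a \<in> I \<Longrightarrow> b \<in> I \<Longrightarrow> a * b \<in> I" "card I = 6"
  shows "I = Sq"
proof (rule card_subset_eq)
  show "I \<subseteq> Sq" using closed_pow_card[OF assms(1,2)] assms(3) pow6_iff by auto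
qed (simp_all add: assms card_Sq)

text \<open>4 and 10 are the two elements of multiplicative order 6.\<close>
lemma four_ten_pow:
  assumes "a \<in> {4, 10 :: 'f}" "a ^ k = 1"
  shows "6 dvd k"
proof -
  have 6: "a ^ 6 = 1" using assms(1) by (auto simp: pow6_iff Sq_def)
  have "a ^ k = (a ^ 6) ^ (k div 6) * a ^ (k mod 6)" by (simp flip: power_mult power_add)
  then have "a ^ (k mod 6) = 1" using 6 assms(2) by simp
  moreover have "k mod 6 \<in> {0,1,2,3,4,5}" by (simp; presburger)
  ultimately have "k mod 6 = 0" using assms(1) by (auto simp: numeral_eq13)
  then show ?thesis by auto
qed

end

section \<open>Groups of order 1092 with an element of order 13\<close>

locale group1092 = group G + field13 ty for G :: "('a, 'b) monoid_scheme" (structure) and ty :: "'f::field itself" +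
  fixes x :: 'a
  assumes order_G: "order G = 1092"
    and x_carrier [simp]: "x \<in> carrier G"
    and ord_x: "ord x = 13"
begin

lemma fin: "finite (carrier G)"
  using order_G by (metis card.infinite order_def zero_neq_numeral)

lemma prime13: "prime (13::nat)" by (simp add: prime_nat_numeral_eq)

lemma order_factor: "order G = 13 * 84" "\<not> 13 dvd (84::nat)"
  by (simp_all add: order_G)

lemma pow_eq_x: "x [^] (i::nat) = x [^] j \<longleftrightarrow> (of_nat i :: 'f) = of_nat j"
  by (simp add: pow_eq_mod ord_x of_nat_eq13)

text \<open>Powers of \<open>x\<close> with exponents in the field, which is possible because \<open>x\<close> has order 13.\<close>
definition X :: "'f \<Rightarrow> 'a" where "X b = x [^] (SOME k::nat. of_nat k = b)"

lemma X_of_nat [simp]: "X (of_nat k) = x [^] k"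
proof -
  have "of_nat (SOME j. of_nat j = (of_nat k :: 'f)) = (of_nat k :: 'f)"
    by (rule someI[of "\<lambda>j. of_nat j = (of_nat k :: 'f)"]) simp
  then show ?thesis unfolding X_def pow_eq_x by simp
qed

lemma ex_of_nat: "\<exists>k. (b :: 'f) = of_nat k"
  using UNIV13 by blast

lemma X_carrier [simp]: "X b \<in> carrier G"
  by (simp add: X_def)

lemma X_add: "X (b + c) = X b \<otimes> X c"
proof -
  obtain i j where "b = of_nat i" "c = of_nat j" using ex_of_nat by metis
  moreover have "X (of_nat (i + j)) = x [^] i \<otimes> x [^] j" unfolding X_of_nat by (simp add: nat_pow_mult)
  ultimately show ?thesis by simp
qed

lemma X_0 [simp]: "X 0 = \<one>" using X_of_nat[of 0] by simp
lemma X_1 [simp]: "X 1 = x" using X_of_nat[of 1] by simp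

lemma X_inj [simp]: "X b = X c \<longleftrightarrow> b = c"
  using pow_eq_x ex_of_nat[of b] ex_of_nat[of c] by auto

lemma X_eq_one [simp]: "X b = \<one> \<longleftrightarrow> b = 0"
  using X_inj[of b 0] by simp

lemma range_X: "range X = powers x"
proof -
  have "range (of_nat :: nat \<Rightarrow> 'f) = UNIV" using ex_of_nat by blast
  then have "range X = X ` range of_nat" by simp
  then show ?thesis by (simp add: powers_def image_image)
qed

lemma X_in_powers [simp]: "X b \<in> powers x" using range_X by blast

lemma X_minus: "inv (X b) = X (- b)"
  using X_add[of "- b" b] by (intro inv_equality) simp_all

lemma X_pow: "X b [^] k = X (of_nat k * b)"
  by (induction k) (simp_all add: ring_distribs add.commute flip: X_add)

lemmas N_sub = normalizer_subgroup[OF fin x_carrier]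
lemmas C_sub = centralizer_subgroup[OF x_carrier]

lemma N_carrier: "n \<in> normalizer x \<Longrightarrow> n \<in> carrier G" by (simp add: normalizer_def)

text \<open>Conjugation by \<open>n\<close> acts on the exponents of \<open>x\<close> as multiplication by \<open>multiplier n\<close>. On the normalizer this
  is a homomorphism to the multiplicative group of the field, with the centralizer as its kernel.\<close>
definition multiplier :: "'a \<Rightarrow> 'f" where "multiplier n = (THE a. n \<otimes> x \<otimes> inv n = X a)"

lemma X_conj:
  assumes "n \<in> normalizer x"
  shows "n \<otimes> X b \<otimes> inv n = X (multiplier n * b)"
proof -
  have "n \<otimes> x \<otimes> inv n \<in> range X" using assms by (simp add: range_X normalizer_def)
  then obtain a where a: "n \<otimes> x \<otimes> inv n = X a" by auto
  then have m: "multiplier n = a" by (simp add: multiplier_def)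
  obtain k where k: "b = of_nat k" using ex_of_nat by blast
  have "n \<otimes> x [^] k \<otimes> inv n = X a [^] k" using N_carrier[OF assms] a by (simp flip: conj_pow)
  then show ?thesis by (simp add: k m X_pow mult.commute)
qed

lemma multiplier_eq: "n \<in> normalizer x \<Longrightarrow> n \<otimes> x \<otimes> inv n = X a \<Longrightarrow> multiplier n = a"
  using X_conj[of n 1] by simp

lemma multiplier_mult:
  assumes "n \<in> normalizer x" "n' \<in> normalizer x"
  shows "multiplier (n \<otimes> n') = multiplier n * multiplier n'"
proof (rule multiplier_eq)
  show "n \<otimes> n' \<in> normalizer x" using assms N_sub by (simp add: subgroup.m_closed)
  have "n \<otimes> (n' \<otimes> X 1 \<otimes> inv n') \<otimes> inv n = X (multiplier n * multiplier n')"
    unfolding X_conj[OF assms(2)] X_conj[OF assms(1)] by simp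
  then show "(n \<otimes> n') \<otimes> x \<otimes> inv (n \<otimes> n') = X (multiplier n * multiplier n')"
    using assms N_carrier by (simp add: conj_conj)
qed

lemma one_N: "\<one> \<in> normalizer x" using N_sub by (simp add: subgroup.one_closed)

lemma multiplier_one [simp]: "multiplier \<one> = 1" using one_N by (intro multiplier_eq) simp_all

lemma multiplier_nonzero:
  assumes "n \<in> normalizer x"
  shows "multiplier n \<noteq> 0"
proof -
  have "inv n \<in> normalizer x" using assms N_sub by (simp add: subgroup.m_inv_closed)
  then have "multiplier n * multiplier (inv n) = 1" using multiplier_mult[OF assms, of "inv n", symmetric] N_carrier[OF assms] by simp
  then show ?thesis by auto
qed

lemma multiplier_inv:
  assumes "n \<in> normalizer x"
  shows "multiplier (inv n) = inverse (multiplier n)"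
proof -
  have "inv n \<in> normalizer x" using assms N_sub by (simp add: subgroup.m_inv_closed)
  then have "multiplier n * multiplier (inv n) = 1" using multiplier_mult[OF assms, of "inv n", symmetric] N_carrier[OF assms] by simp
  then show ?thesis by (simp add: inverse_unique)
qed

lemma pow_N: "n \<in> normalizer x \<Longrightarrow> n [^] (k::nat) \<in> normalizer x"
  using powers_subset[OF N_sub] by (auto simp: powers_def)

lemma multiplier_pow: "n \<in> normalizer x \<Longrightarrow> multiplier (n [^] (k::nat)) = multiplier n ^ k"
  by (induction k) (simp_all add: multiplier_mult pow_N)

lemma multiplier_eq_one_iff: "n \<in> normalizer x \<Longrightarrow> multiplier n = 1 \<longleftrightarrow> n \<in> centralizer x"
  using X_conj[of n 1] N_carrier[of n] conj_eq_self_iff[of n x] X_inj[of "multiplier n" 1]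
  by (auto simp: centralizer_def simp del: X_inj)

lemma centralizer_N: "centralizer x \<subseteq> normalizer x" using centralizer_le_normalizer by simp

lemma X_N [simp]: "X b \<in> normalizer x"
  using powers_le_centralizer[of x] centralizer_N by (auto intro: X_in_powers subsetD)

lemma card_multiplier_fibre:
  assumes n: "n \<in> normalizer x"
  shows "card {h \<in> normalizer x. multiplier h = multiplier n} = card (centralizer x)"
proof -
  have "bij_betw (\<lambda>c. n \<otimes> c) (centralizer x) {h \<in> normalizer x. multiplier h = multiplier n}"
  proof (rule bij_betw_byWitness[where f' = "\<lambda>h. inv n \<otimes> h"])
    show "(\<lambda>c. n \<otimes> c) ` centralizer x \<subseteq> {h \<in> normalizer x. multiplier h = multiplier n}"
    proof clarify
      fix c assume c: "c \<in> centralizer x"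
      then have "c \<in> normalizer x" using centralizer_N by blast
      then show "n \<otimes> c \<in> normalizer x \<and> multiplier (n \<otimes> c) = multiplier n"
        using c n N_sub multiplier_eq_one_iff by (simp add: subgroup.m_closed multiplier_mult)
    qed
    show "(\<lambda>h. inv n \<otimes> h) ` {h \<in> normalizer x. multiplier h = multiplier n} \<subseteq> centralizer x"
    proof clarify
      fix h assume h: "h \<in> normalizer x" "multiplier h = multiplier n"
      have i: "inv n \<in> normalizer x" using n N_sub by (simp add: subgroup.m_inv_closed)
      then have "inv n \<otimes> h \<in> normalizer x" using h N_sub by (simp add: subgroup.m_closed)
      moreover have "multiplier (inv n \<otimes> h) = 1" using h n i multiplier_nonzero[OF n] by (simp add: multiplier_mult multiplier_inv)
      ultimately show "inv n \<otimes> h \<in> centralizer x" using multiplier_eq_one_iff by blast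
    qed
  qed (use N_carrier n in \<open>auto simp: inv_mult_cancel centralizer_def\<close>)
  then show ?thesis by (simp add: bij_betw_same_card)
qed

lemma card_multiplier_preimage:
  assumes "I \<subseteq> multiplier ` normalizer x"
  shows "card {h \<in> normalizer x. multiplier h \<in> I} = card I * card (centralizer x)"
proof -
  have finN: "finite (normalizer x)" using subgroup_finite(1)[OF fin N_sub] .
  have "card {h \<in> normalizer x. multiplier h \<in> I} = card (\<Union>a\<in>I. {h \<in> normalizer x. multiplier h = a})"
    by (rule arg_cong[of _ _ card]) auto
  also have "\<dots> = (\<Sum>a\<in>I. card {h \<in> normalizer x. multiplier h = a})"
    using finN by (intro card_UN_disjoint) auto
  also have "\<dots> = (\<Sum>a\<in>I. card (centralizer x))"
    using assms card_multiplier_fibre by (intro sum.cong) auto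
  finally show ?thesis by simp
qed

lemma card_multiplier_image: "card (normalizer x) = card (multiplier ` normalizer x) * card (centralizer x)"
proof -
  have "{h \<in> normalizer x. multiplier h \<in> multiplier ` normalizer x} = normalizer x" by auto
  then show ?thesis using card_multiplier_preimage[OF subset_refl] by simp
qed

lemma multiplier_image_closed:
  "0 \<notin> multiplier ` normalizer x" "a \<in> multiplier ` normalizer x \<Longrightarrow> b \<in> multiplier ` normalizer x \<Longrightarrow> a * b \<in> multiplier ` normalizer x"
proof -
  show "0 \<notin> multiplier ` normalizer x" using multiplier_nonzero by force
  show "a * b \<in> multiplier ` normalizer x" if ab: "a \<in> multiplier ` normalizer x" "b \<in> multiplier ` normalizer x"
  proof -
    obtain g h where gh: "g \<in> normalizer x" "h \<in> normalizer x" "a = multiplier g" "b = multiplier h" using ab by blast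
    then have "g \<otimes> h \<in> normalizer x" using N_sub by (simp add: subgroup.m_closed)
    then show ?thesis using gh by (simp flip: multiplier_mult)
  qed
qed

lemma card_centralizer: "\<exists>m. card (centralizer x) = 13 * m \<and> m dvd 84 \<and> \<not> 13 dvd m"
proof -
  have "13 dvd card (centralizer x)"
    using subgroup_card_dvd[OF powers_subgroup[OF fin x_carrier] C_sub powers_le_centralizer[OF x_carrier]]
    by (simp add: card_powers fin ord_x)
  then obtain m where m: "card (centralizer x) = 13 * m" by (auto simp: dvd_def)
  have "card (centralizer x) dvd 13 * 84"
    using subgroup_card_dvd[OF C_sub subgroup_self] order_factor by (simp add: order_def centralizer_def)
  then have "m dvd 84" using m by simp
  then show ?thesis using m by (metis dvd_trans order_factor(2))
qed

text \<open>The order of the multiplier of \<open>g\<close>, here 6, divides the order of \<open>g\<close>.\<close>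
lemma composite_if_multiplier:
  assumes "g \<in> normalizer x" "multiplier g \<in> {4, 10}"
  shows "g \<noteq> \<one>" "\<not> prime (ord g)"
proof -
  have gG: "g \<in> carrier G" using assms(1) by (rule N_carrier)
  have "multiplier g ^ ord g = multiplier (g [^] ord g)" by (simp add: multiplier_pow[OF assms(1)])
  also have "\<dots> = 1" using gG by simp
  finally have 6: "6 dvd ord g" using four_ten_pow[OF assms(2)] by blast
  show "\<not> prime (ord g)"
  proof
    assume p: "prime (ord g)"
    have "2 dvd ord g" "3 dvd ord g" using dvd_trans[OF _ 6] by simp_all
    then show False using primes_dvd_imp_eq[OF two_is_prime_nat p] by auto
  qed
  show "g \<noteq> \<one>" using 6 by auto
qed

text \<open>With \<open>card (normalizer x) = 13 * d\<close>, the count of double cosets says that \<open>13 * d\<close> divides \<open>84 - d\<close>, so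
  \<open>d\<close> is congruent to 6 modulo 13; among the divisors of 84 only 6 and 84 are.\<close>
lemma card_normalizer: "card (normalizer x) = 78 \<or> normalizer x = carrier G"
proof -
  obtain d where d: "card (normalizer x) = 13 * d" "d dvd 84" "\<not> 13 dvd d"
    using card_normalizer_factor[OF fin x_carrier ord_x prime13 order_factor] by blast
  have "13 * (13 * d) dvd 13 * 84 - 13 * d"
    using double_coset_dvd[OF fin x_carrier ord_x prime13 order_factor] d order_G by simp
  then have "13 * (13 * d) dvd 13 * (84 - d)" by (simp add: right_diff_distrib')
  then have "13 * d dvd 84 - d" by (simp only: nat_mult_dvd_cancel1[of 13] zero_less_numeral)
  then have 13: "13 dvd 84 - d" by (metis dvd_mult_left)
  have "d \<le> 84" using d(2) by (simp add: dvd_imp_le)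
  obtain q where q: "84 - d = 13 * q" using 13 by (auto simp: dvd_def)
  then have "d = 84 - 13 * q" "q \<le> 6" using \<open>d \<le> 84\<close> by auto
  then have "d \<in> {84, 71, 58, 45, 32, 19, 6}" by (auto simp: le_Suc_eq numeral_eq_Suc)
  then have "d = 6 \<or> d = 84" using d(2) by auto
  then show ?thesis
  proof
    assume "d = 84"
    then have "card (normalizer x) = card (carrier G)" using d(1) order_G by (simp add: order_def)
    then show ?thesis using card_subset_eq[OF fin] N_sub subgroup.subset by blast
  qed (use d(1) in simp)
qed

lemma mixed_centralizer:
  assumes "card (centralizer x) = 13 * m" "\<not> 13 dvd m"
  shows "12 * (m - 1) \<le> card (mixed (centralizer x) x m)"
    "g \<in> mixed (centralizer x) x m \<Longrightarrow> g \<noteq> \<one> \<and> \<not> prime (ord g)"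
proof -
  have xC: "x \<in> centralizer x" by (simp add: centralizer_def)
  show "12 * (m - 1) \<le> card (mixed (centralizer x) x m)"
    using card_mixed[OF fin C_sub subset_refl xC prime13 ord_x assms] by simp
  show "g \<in> mixed (centralizer x) x m \<Longrightarrow> g \<noteq> \<one> \<and> \<not> prime (ord g)"
    using mixed_not_prime[OF fin C_sub subset_refl xC prime13 ord_x assms] by blast
qed

lemma mixed_subset: "mixed D y m \<subseteq> D" by (auto simp: mixed_def)

lemma Omega_rho_gt_if_composite:
  assumes "E \<subseteq> carrier G" "\<And>g. g \<in> E \<Longrightarrow> g \<noteq> \<one> \<and> \<not> prime (ord g)" "183 \<le> card E"
  shows "1273 < Omega_rho G"
  using Omega_rho_ge[OF fin assms(1,2)] assms(3) order_G by linarith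

text \<open>Let the centralizer have order \<open>13 * m\<close>. It contains at least \<open>12 * (m - 1)\<close> elements of composite order, which
  is enough for \<open>m \<ge> 21\<close>. Otherwise the group of multipliers, of order \<open>84 div m \<le> 12\<close>, has order 12 or
  6 and thus contains 4 and 10; these multipliers add \<open>26 * m\<close> elements of composite order outside the
  centralizer.\<close>
lemma Omega_rho_gt_if_normal:
  assumes N: "normalizer x = carrier G"
  shows "1273 < Omega_rho G"
proof -
  let ?I = "multiplier ` normalizer x"
  obtain m where m: "card (centralizer x) = 13 * m" "m dvd 84" "\<not> 13 dvd m" using card_centralizer by blast
  let ?M = "mixed (centralizer x) x m" and ?E = "{h \<in> normalizer x. multiplier h \<in> {4, 10}}"
  have "1092 = card ?I * (13 * m)" using card_multiplier_image m(1) N order_G by (simp add: order_def)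
  then have Im: "card ?I * m = 84" by (simp add: mult.commute)
  have "?I \<subseteq> UNIV - {0}" using multiplier_image_closed(1) by blast
  then have "card ?I \<le> card (UNIV - {0 :: 'f})" by (rule card_mono[rotated]) simp
  then have I12: "card ?I \<le> 12" using card13 by (simp add: card_Diff_subset)
  note M = mixed_centralizer[OF m(1,3)]
  show ?thesis
  proof (cases "m \<ge> 21")
    case True
    show ?thesis
      by (rule Omega_rho_gt_if_composite[of ?M]) (use M True mixed_subset[of "centralizer x" x m] C_sub in \<open>auto dest: subgroup.mem_carrier\<close>)
  next
    case False
    have "84 \<le> 12 * m" using Im I12 by (metis mult_le_mono1)
    then have "m \<in> {7..20}" using False by auto
    then have "m \<in> {7,8,9,10,11,12,13,14,15,16,17,18,19,20}" by (simp; presburger)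
    then have "m = 7 \<or> m = 12 \<or> m = 14" using m(2) by auto
    \<comment> \<open>A group of 7 multipliers is impossible: 1 is the only field element whose seventh power is 1.\<close>
    moreover have "m \<noteq> 12"
    proof
      assume "m = 12"
      then have 7: "card ?I = 7" using Im by simp
      then have "?I \<subseteq> {1}" using closed_pow_card[OF multiplier_image_closed] pow7 by auto
      then have "card ?I \<le> card {1 :: 'f}" by (rule card_mono[rotated]) simp
      then show False using 7 by simp
    qed
    ultimately have m714: "m = 7 \<or> m = 14" by blast
    have sub: "{4, 10} \<subseteq> ?I"
    proof (cases "m = 7")
      case True
      then have "card ?I = card (UNIV - {0 :: 'f})" using Im card13 by (simp add: card_Diff_subset)
      then have "?I = UNIV - {0}" using \<open>?I \<subseteq> UNIV - {0}\<close> by (intro card_subset_eq) auto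
      then show ?thesis by (auto simp: numeral_eq13)
    next
      case False
      then have "card ?I = 6" using m714 Im by simp
      then have "?I = Sq" using closed_card6[OF multiplier_image_closed] by blast
      then show ?thesis by (auto simp: Sq_def)
    qed
    have "card {4, 10 :: 'f} = 2" by (simp add: numeral_eq13)
    then have E: "card ?E = 26 * m" using card_multiplier_preimage[OF sub] m(1) by simp
    have "multiplier g = 1" if "g \<in> ?M" for g
      using multiplier_eq_one_iff[of g] mixed_subset[of "centralizer x" x m] centralizer_N that by blast
    then have disj: "?E \<inter> ?M = {}" by (auto simp: numeral_eq13)
    have sub: "?E \<union> ?M \<subseteq> carrier G"
      using mixed_subset[of "centralizer x" x m] C_sub N by (auto dest: subgroup.mem_carrier)
    then have "finite ?E" "finite ?M" using fin by (auto intro: finite_subset)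
    then have "card (?E \<union> ?M) = 26 * m + card ?M" using disj E by (simp add: card_Un_disjoint)
    then show ?thesis using sub M m714 composite_if_multiplier
      by (intro Omega_rho_gt_if_composite[of "?E \<union> ?M"]) auto
  qed
qed

text \<open>The \<open>m\<close>-th power of a mixed element generates \<open>powers x\<close>, so only elements of the normalizer, which has index
  14, can conjugate one mixed element into another.\<close>
lemma card_conj_mixed:
  assumes N: "card (normalizer x) = 78" and m: "card (centralizer x) = 13 * m" "\<not> 13 dvd m"
  shows "14 * card (mixed (centralizer x) x m) \<le> card (conjugates (mixed (centralizer x) x m))"
proof -
  let ?M = "mixed (centralizer x) x m"
  have MG: "?M \<subseteq> carrier G" using mixed_subset[of "centralizer x" x m] by (auto simp: centralizer_def)
  have xC: "x \<in> centralizer x" by (simp add: centralizer_def)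
  have "order G * card ?M \<le> card (conjugates ?M) * card (normalizer x)"
  proof (rule card_conjugates[OF fin MG])
    fix g y assume g: "g \<in> carrier G" and y: "y \<in> ?M" "g \<otimes> y \<otimes> inv g \<in> ?M"
    have P: "z [^] m \<in> powers x" if "z \<in> ?M" for z
      using central_pow_in_powers[OF fin C_sub subset_refl xC ord_x m(1)] that mixed_subset by blast
    have "y [^] m \<noteq> \<one>" using y(1) by (simp add: mixed_def)
    moreover have "g \<otimes> y [^] m \<otimes> inv g \<in> powers x" using P[OF y(2)] g y(1) MG by (auto simp: conj_pow)
    ultimately show "g \<in> normalizer x" using normalizerI_prime[OF fin x_carrier _ g P[OF y(1)]] prime13 by (simp add: ord_x)
  qed (auto simp: normalizer_def)
  then show ?thesis using order_G N by simp
qed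

text \<open>The conjugates of the 12 elements of order 26 in the centralizer are only 168 elements of composite order. A further
  26 come from the involution \<open>t\<close> of the centralizer: as its only involution, \<open>t\<close> is central in the normalizer,
  so that multiplication by \<open>t\<close> produces composite orders in all of the normalizer and not just in the
  centralizer.\<close>
lemma Omega_rho_gt_if_centralizer_26:
  assumes N: "card (normalizer x) = 78" and C: "card (centralizer x) = 13 * 2"
  shows "1273 < Omega_rho G"
proof -
  let ?M = "mixed (centralizer x) x 2"
  have M: "12 \<le> card ?M" using mixed_centralizer(1)[OF C] by simp
  have M': "g \<noteq> \<one> \<and> \<not> prime (ord g)" if "g \<in> ?M" for g using mixed_centralizer(2)[OF C _ that] by simp
  have MG: "?M \<subseteq> carrier G" using mixed_subset[of "centralizer x" x] by (auto simp: centralizer_def)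
  have xC: "x \<in> centralizer x" by (simp add: centralizer_def)
  interpret C: group "G\<lparr>carrier := centralizer x\<rparr>" using C_sub by (rule subgroup_imp_group)
  have "\<exists>t\<in>centralizer x. ord t = 2"
    using C.Cauchy[of 2] C subgroup_finite(1)[OF fin C_sub] by (auto simp: order_def ord_subgroup C_sub)
  then obtain t where t: "t \<in> centralizer x" "ord t = 2" by blast
  have tG: "t \<in> carrier G" using t by (simp add: centralizer_def)
  have t1: "t \<noteq> \<one>" "t [^] (2::nat) = \<one>" using t tG pow_ord_eq_1[OF tG] by auto
  let ?K = "{g \<in> centralizer x. g [^] (2::nat) = \<one>}"
  have "?K = {\<one>, t}"
  proof (rule card_seteq[symmetric])
    show "finite ?K" using subgroup_finite(1)[OF fin C_sub] by simp
    show "{\<one>, t} \<subseteq> ?K" using t t1 C_sub by (auto simp: subgroup.one_closed)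
    show "card ?K \<le> card {\<one>, t}"
      using card_roots_le[OF fin C_sub subset_refl xC prime13 ord_x C] t1 by simp
  qed
  then have uniq: "s = t" if "s \<in> centralizer x" "s [^] (2::nat) = \<one>" "s \<noteq> \<one>" for s using that by blast
  have Nt: "normalizer x \<subseteq> centralizer t"
  proof
    fix g assume g: "g \<in> normalizer x"
    have gG: "g \<in> carrier G" using g by (rule N_carrier)
    have i: "inv g \<in> normalizer x" using g N_sub by (simp add: subgroup.m_inv_closed)
    have tN: "t \<in> normalizer x" using t centralizer_N by blast
    have "g \<otimes> t \<otimes> inv g \<in> normalizer x" using g i tN N_sub by (simp add: subgroup.m_closed)
    moreover have "multiplier (g \<otimes> t \<otimes> inv g) = 1"
      using g i tN N_sub multiplier_nonzero[OF g] multiplier_eq_one_iff[OF tN] t(1) by (simp add: multiplier_mult multiplier_inv subgroup.m_closed)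
    ultimately have "g \<otimes> t \<otimes> inv g \<in> centralizer x" by (simp add: multiplier_eq_one_iff)
    moreover have "(g \<otimes> t \<otimes> inv g) [^] (2::nat) = \<one>" using gG tG t1 by (simp add: conj_pow del: nat_pow_Suc)
    ultimately have "g \<otimes> t \<otimes> inv g = t" using t1(1) gG tG by (intro uniq) (simp_all add: conj_eq_one_iff del: nat_pow_Suc)
    then show "g \<in> centralizer t" using conj_eq_self_iff[OF gG tG] gG by (simp add: centralizer_def)
  qed
  \<comment> \<open>At most 12 of the at least 38 elements of this set lie in the centralizer.\<close>
  let ?B = "mixed (normalizer x) t 39"
  have tN: "t \<in> normalizer x" using t centralizer_N by blast
  have two: "prime (2::nat)" by simp
  have cardN: "card (normalizer x) = 2 * 39" "\<not> 2 dvd (39::nat)" using N by simp_all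
  have B: "38 \<le> card ?B" using card_mixed[OF fin N_sub Nt tN two t(2) cardN] by simp
  have B': "g \<noteq> \<one> \<and> \<not> prime (ord g)" if "g \<in> ?B" for g
    using mixed_not_prime[OF fin N_sub Nt tN two t(2) cardN that] by blast
  have BG: "?B \<subseteq> carrier G" using mixed_subset[of "normalizer x" t] N_carrier by blast
  have finC: "finite (centralizer x)" using subgroup_finite(1)[OF fin C_sub] .
  have "?B \<inter> centralizer x \<subseteq> centralizer x - (powers x \<union> {t})"
  proof -
    have "g \<notin> ?B" if "g \<in> powers x" for g
    proof -
      obtain b where "g = X b" using \<open>g \<in> powers x\<close> range_X by blast
      moreover have "(of_nat 39 :: 'f) = 0" by (simp add: numeral_eq13)
      ultimately have "g [^] (39::nat) = \<one>" by (simp add: X_pow del: of_nat_numeral)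
      then show ?thesis by (simp add: mixed_def)
    qed
    moreover have "t \<notin> ?B" using self_in_powers[OF tG] by (simp add: mixed_def)
    ultimately show ?thesis by blast
  qed
  then have "card (?B \<inter> centralizer x) \<le> card (centralizer x - (powers x \<union> {t}))" using finC by (intro card_mono) auto
  also have "\<dots> = card (centralizer x) - card (powers x \<union> {t})"
    using finC powers_le_centralizer[OF x_carrier] t(1) by (intro card_Diff_subset) (auto intro: finite_subset)
  also have "card (powers x \<union> {t}) = 14"
  proof -
    have "t \<notin> powers x" using ord_in_powers_prime[OF fin x_carrier _ _ t1(1)] t(2) prime13 by (auto simp: ord_x)
    moreover have "finite (powers x)" using subgroup_finite(1)[OF fin powers_subgroup[OF fin x_carrier]] .
    ultimately show ?thesis by (simp add: card_powers fin ord_x)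
  qed
  finally have BC: "card (?B \<inter> centralizer x) \<le> 12" using C by simp
  have finB: "finite ?B" using BG fin finite_subset by blast
  have "card (?B - centralizer x) = card ?B - card (?B \<inter> centralizer x)" using finB by (simp add: card_Diff_subset_Int)
  then have BmC: "26 \<le> card (?B - centralizer x)" using B BC by linarith
  \<comment> \<open>An element of the normalizer that is conjugate to one of order 26 in the centralizer lies in the centralizer.\<close>
  have disj: "(?B - centralizer x) \<inter> conjugates ?M = {}"
  proof (rule ccontr)
    assume "(?B - centralizer x) \<inter> conjugates ?M \<noteq> {}"
    then obtain z where z: "z \<in> ?B" "z \<notin> centralizer x" "z \<in> conjugates ?M" by blast
    then obtain g y where gy: "g \<in> carrier G" "y \<in> ?M" "z = g \<otimes> y \<otimes> inv g" by (auto simp: conjugates_def)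
    have yC: "y \<in> centralizer x" and yG: "y \<in> carrier G" using gy(2) MG by (auto simp: mixed_def)
    have zG: "z \<in> carrier G" and zN: "z \<in> normalizer x" using z(1) BG by (auto simp: mixed_def)
    define u where "u = g \<otimes> x \<otimes> inv g"
    have uG: "u \<in> carrier G" using gy(1) by (simp add: u_def)
    have "z \<otimes> u = g \<otimes> (y \<otimes> x) \<otimes> inv g" using gy yG by (simp add: u_def conj_mult)
    also have "\<dots> = g \<otimes> (x \<otimes> y) \<otimes> inv g" using yC by (simp add: centralizer_def)
    also have "\<dots> = u \<otimes> z" using gy yG by (simp add: u_def conj_mult)
    finally have zu: "z \<otimes> u = u \<otimes> z" .
    have y2: "y [^] (2::nat) \<in> powers x" "y [^] (2::nat) \<noteq> \<one>"
      using central_pow_in_powers[OF fin C_sub subset_refl xC ord_x C yC] gy(2) by (auto simp: mixed_def)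
    then obtain k :: nat where k: "x = (y [^] (2::nat)) [^] k"
      using prime_generator[OF fin x_carrier _ y2] prime13 by (auto simp: ord_x)
    have "u = (z [^] (2::nat)) [^] k" unfolding u_def gy(3)
      by (subst k) (use gy(1) yG in \<open>simp add: conj_pow del: nat_pow_Suc\<close>)
    then have "u \<in> normalizer x" using pow_N zN by blast
    moreover have "ord u = 13" using gy(1) ord_x by (simp add: u_def ord_conj)
    ultimately have uP: "u \<in> powers x"
      using normalizer_pow_one_in_powers[OF fin x_carrier ord_x prime13 order_factor] uG by (metis pow_ord_eq_1)
    have "u \<noteq> \<one>" using \<open>ord u = 13\<close> by auto
    then obtain j :: nat where "x = u [^] j"
      using prime_generator[OF fin x_carrier _ uP] prime13 by (auto simp: ord_x)
    then have "z \<otimes> x = x \<otimes> z" using group_commutes_pow[OF zu[symmetric] uG zG] by simp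
    then show False using z(2) zG by (simp add: centralizer_def)
  qed
  have cm: "168 \<le> card (conjugates ?M)" using card_conj_mixed[OF N C] M by simp
  let ?E = "(?B - centralizer x) \<union> conjugates ?M"
  have finM: "finite (conjugates ?M)" using conjugates_subset[OF MG] fin finite_subset by blast
  have "card ?E = card (?B - centralizer x) + card (conjugates ?M)" using finB finM disj by (simp add: card_Un_disjoint)
  moreover have "g \<noteq> \<one> \<and> \<not> prime (ord g)" if "g \<in> conjugates ?M" for g
    using ord_conjugates[OF MG that] M' MG ord_eq_1 conjugates_subset[OF MG] that by (metis subsetD)
  ultimately show ?thesis using BmC cm B' BG conjugates_subset[OF MG]
    by (intro Omega_rho_gt_if_composite[of ?E]) auto
qed

text \<open>If \<open>powers x\<close> is not normal, the order of the centralizer is \<open>13 * m\<close> for a divisor \<open>m > 1\<close> of 6. For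
  \<open>m \<ge> 3\<close> there are already \<open>14 * 12 * 2 = 336\<close> or more conjugates of mixed elements.\<close>
lemma Omega_rho_gt:
  assumes "normalizer x = carrier G \<or> centralizer x \<noteq> powers x"
  shows "1273 < Omega_rho G"
proof (cases "normalizer x = carrier G")
  case True
  then show ?thesis by (rule Omega_rho_gt_if_normal)
next
  case False
  then have N: "card (normalizer x) = 78" using card_normalizer by blast
  have "centralizer x \<noteq> powers x" using False assms by blast
  obtain m where m: "card (centralizer x) = 13 * m" "m dvd 84" "\<not> 13 dvd m" using card_centralizer by blast
  have "card (centralizer x) dvd card (normalizer x)" using subgroup_card_dvd[OF C_sub N_sub centralizer_N] .
  then have "13 * m dvd 13 * 6" using N m by simp
  then have m6: "m dvd 6" by (simp only: nat_mult_dvd_cancel1[of 13] zero_less_numeral)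
  have "m \<noteq> 1"
  proof
    assume "m = 1"
    then have "powers x = centralizer x"
      using m(1) subgroup_finite(1)[OF fin C_sub] powers_le_centralizer[OF x_carrier]
      by (intro card_subset_eq) (auto simp: card_powers fin ord_x)
    then show False using \<open>centralizer x \<noteq> powers x\<close> by simp
  qed
  have "m \<le> 6" using m6 by (simp add: dvd_imp_le)
  then have "m \<in> {0,1,2,3,4,5,6}" by (simp; presburger)
  then have "m = 2 \<or> m = 3 \<or> m = 6" using m6 \<open>m \<noteq> 1\<close> by auto
  then consider "m = 2" | "m \<ge> 3" by linarith
  then show ?thesis
  proof cases
    case 1
    then show ?thesis using Omega_rho_gt_if_centralizer_26 N m(1) by simp
  next
    case 2
    let ?M = "mixed (centralizer x) x m"
    have MG: "?M \<subseteq> carrier G" using mixed_subset[of "centralizer x" x] by (auto simp: centralizer_def)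
    have "14 * (12 * (m - 1)) \<le> card (conjugates ?M)"
      using card_conj_mixed[OF N m(1,3)] mixed_centralizer(1)[OF m(1,3)] by linarith
    moreover have "g \<noteq> \<one> \<and> \<not> prime (ord g)" if "g \<in> conjugates ?M" for g
      using ord_conjugates[OF MG that] mixed_centralizer(2)[OF m(1,3)] MG ord_eq_1 conjugates_subset[OF MG] that
      by (metis subsetD)
    ultimately show ?thesis using 2 conjugates_subset[OF MG]
      by (intro Omega_rho_gt_if_composite[of "conjugates ?M"]) auto
  qed
qed

end

section \<open>Moebius transformations\<close>

definition mat2 :: "'f \<Rightarrow> 'f \<Rightarrow> 'f \<Rightarrow> 'f \<Rightarrow> 'f::field^2^2"
  where "mat2 a b c d = vector [vector [a, b], vector [c, d]]"

lemma mat2_nth [simp]: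
  "mat2 a b c d $ 1 $ 1 = a" "mat2 a b c d $ 1 $ 2 = b" "mat2 a b c d $ 2 $ 1 = c" "mat2 a b c d $ 2 $ 2 = d"
  by (simp_all add: mat2_def)

lemma mat2_collapse: "mat2 (A $ 1 $ 1) (A $ 1 $ 2) (A $ 2 $ 1) (A $ 2 $ 2) = A"
  by (simp add: vec_eq_iff forall_2)

lemma mat2_eq_iff: "A = B \<longleftrightarrow> A $ 1 $ 1 = B $ 1 $ 1 \<and> A $ 1 $ 2 = B $ 1 $ 2 \<and> A $ 2 $ 1 = B $ 2 $ 1 \<and> A $ 2 $ 2 = B $ 2 $ 2"
  for A :: "'f::field^2^2"
  by (simp add: vec_eq_iff forall_2)

lemma mat2_mult: "mat2 a b c d ** mat2 a' b' c' d' = mat2 (a*a'+b*c') (a*b'+b*d') (c*a'+d*c') (c*b'+d*d')"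
  by (simp add: mat2_eq_iff matrix_matrix_mult_def sum_2)

lemma det_mat2: "det (mat2 a b c d) = a * d - b * c"
  by (simp add: det_2)

fun homog :: "'f::field option \<Rightarrow> 'f^2"
  where "homog None = vector [1, 0]" | "homog (Some z) = vector [z, 1]"

definition pt :: "'f::field^2 \<Rightarrow> 'f option"
  where "pt v = (if v $ 2 = 0 then None else Some (v $ 1 / v $ 2))"

text \<open>The action on the projective line in homogeneous coordinates, which makes compatibility with the matrix product
  immediate.\<close>
definition mob :: "'f::field^2^2 \<Rightarrow> 'f option \<Rightarrow> 'f option"
  where "mob A p = pt (A *v homog p)"

lemma pt_scale: "c \<noteq> 0 \<Longrightarrow> pt (c *s v) = pt v"
  by (simp add: pt_def)

lemma pt_homog [simp]: "pt (homog p) = p"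
  by (cases p) (simp_all add: pt_def)

lemma homog_pt:
  assumes "v \<noteq> 0"
  shows "\<exists>c. c \<noteq> 0 \<and> v = c *s homog (pt v)"
proof (cases "v $ 2 = 0")
  case True
  then have "v $ 1 \<noteq> 0" using assms by (simp add: vec_eq_iff forall_2)
  then show ?thesis using True by (intro exI[of _ "v $ 1"]) (simp add: pt_def vec_eq_iff forall_2)
next
  case False
  then show ?thesis by (intro exI[of _ "v $ 2"]) (simp add: pt_def vec_eq_iff forall_2)
qed

lemma homog_nonzero: "homog p \<noteq> 0"
  by (cases p) (simp_all add: vec_eq_iff forall_2)

lemma mob_mult:
  assumes "det B \<noteq> 0"
  shows "mob (A ** B) = mob A \<circ> mob B"
proof
  fix p
  obtain B' where "B' ** B = mat 1" using assms by (metis invertible_def invertible_det_nz)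
  then have "B *v homog p \<noteq> 0"
    using homog_nonzero[of p] by (metis matrix_vector_mul_assoc matrix_vector_mul_lid matrix_vector_mult_0_right)
  then obtain c where c: "c \<noteq> 0" "B *v homog p = c *s homog (mob B p)"
    using homog_pt unfolding mob_def by blast
  have "mob (A ** B) p = pt (A *v (B *v homog p))" by (simp add: mob_def matrix_vector_mul_assoc)
  also have "\<dots> = pt (c *s (A *v homog (mob B p)))" by (simp add: c(2) vector_scalar_commute)
  also have "\<dots> = mob A (mob B p)" using c(1) by (simp add: pt_scale mob_def)
  finally show "mob (A ** B) p = (mob A \<circ> mob B) p" by simp
qed

lemma mob_mat2_None: "mob (mat2 a b c d) None = (if c = 0 then None else Some (a / c))"
  by (simp add: mob_def pt_def matrix_vector_mult_def sum_2)

lemma mob_mat2_Some: "mob (mat2 a b c d) (Some z) = (if c * z + d = 0 then None else Some ((a * z + b) / (c * z + d)))"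
  by (simp add: mob_def pt_def matrix_vector_mult_def sum_2)

definition Mob :: "('f::field option \<Rightarrow> 'f option) monoid"
  where "Mob = \<lparr>carrier = mob ` {A. det A = 1}, mult = (\<circ>), one = id\<rparr>"

lemma mob_1: "mob (mat 1) = id"
  by (auto simp: mob_def)

lemma Mob_carrier_mat2:
  "f \<in> carrier Mob \<longleftrightarrow> (\<exists>a b c d. a * d - b * c = 1 \<and> f = mob (mat2 a b c d))"
proof
  assume "f \<in> carrier Mob"
  then obtain A where A: "det A = 1" "f = mob A" by (auto simp: Mob_def)
  then show "\<exists>a b c d. a * d - b * c = 1 \<and> f = mob (mat2 a b c d)"
    using mat2_collapse[of A] det_2[of A] by metis
qed (auto simp: Mob_def det_mat2)

lemma Mob_mult_closed: "f \<in> carrier Mob \<Longrightarrow> g \<in> carrier Mob \<Longrightarrow> f \<circ> g \<in> carrier Mob"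
proof -
  assume "f \<in> carrier Mob" "g \<in> carrier Mob"
  then obtain A B where "det A = 1" "f = mob A" "det B = 1" "g = mob B" by (auto simp: Mob_def)
  then have "f \<circ> g = mob (A ** B)" "det (A ** B) = 1" by (simp_all add: mob_mult det_mul)
  then show "f \<circ> g \<in> carrier Mob" by (auto simp: Mob_def)
qed

lemma group_Mob: "group (Mob :: ('f::field option \<Rightarrow> 'f option) monoid)"
proof (rule groupI)
  fix f g :: "'f option \<Rightarrow> 'f option"
  assume f: "f \<in> carrier Mob"
  show "f \<otimes>\<^bsub>Mob\<^esub> g \<in> carrier Mob" if "g \<in> carrier Mob" using Mob_mult_closed[OF f that] by (simp add: Mob_def)
  obtain A where A: "det A = 1" "f = mob A" using f by (auto simp: Mob_def)
  obtain B where B: "det B = 1" "B ** A = mat 1"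
    using group.l_inv_ex[OF group_SL, of A] A(1) by (auto simp: SL_def)
  have "mob B \<circ> f = id" using mob_mult[of A B] A B by (simp add: mob_1)
  then show "\<exists>h\<in>carrier Mob. h \<otimes>\<^bsub>Mob\<^esub> f = \<one>\<^bsub>Mob\<^esub>" using B by (auto simp: Mob_def)
next
  have "det (mat 1 :: 'f^2^2) = 1" by simp
  then show "\<one>\<^bsub>Mob\<^esub> \<in> carrier (Mob :: ('f option \<Rightarrow> 'f option) monoid)"
    unfolding Mob_def by (auto simp: image_iff mob_1[symmetric] intro!: exI[of _ "mat 1"])
qed (auto simp: Mob_def comp_assoc)

text \<open>Both conditions say that \<open>A\<close> is a scalar matrix: the first by evaluation at infinity, 0 and 1, the second by
  commuting with the two elementary unipotent matrices.\<close>
lemma mob_eq_id_iff: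
  assumes "det A = (1 :: 'f::field)"
  shows "mob A = id \<longleftrightarrow> A \<in> group_center SL"
proof
  obtain a b c d where A: "A = mat2 a b c d" using mat2_collapse[of A] by metis
  assume "mob A = id"
  then have "mob A None = None" "mob A (Some 0) = Some 0" "mob A (Some 1) = Some 1" by simp_all
  then have "c = 0" "b = 0" "a = d"
    using assms by (auto simp: A det_mat2 mob_mat2_None mob_mat2_Some split: if_splits)
  then show "A \<in> group_center SL"
    using assms by (auto simp: A group_center_def SL_def mat2_eq_iff matrix_matrix_mult_def sum_2 mult.commute)
next
  obtain a b c d where A: "A = mat2 a b c d" using mat2_collapse[of A] by metis
  assume "A \<in> group_center SL"
  then have com: "A ** B = B ** A" if "det B = 1" for B using that by (auto simp: group_center_def SL_def)
  have "c = 0" "a = d" "b = 0"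
    using com[of "mat2 1 1 0 1"] com[of "mat2 1 0 1 1"] by (auto simp: A det_mat2 mat2_mult mat2_eq_iff)
  then have "mob A p = p" for p using assms by (cases p) (auto simp: A det_mat2 mob_mat2_None mob_mat2_Some)
  then show "mob A = id" by auto
qed

lemma mob_hom: "group_hom (SL :: ('f::field^2^2) monoid) Mob mob"
  by (intro group_hom.intro group_hom_axioms.intro group_SL group_Mob homI)
    (auto simp: SL_def Mob_def mob_mult)

lemma L2_iso_Mob: "L2 TYPE('f::field) \<cong> (Mob :: ('f option \<Rightarrow> 'f option) monoid)"
proof -
  interpret group_hom "SL :: ('f^2^2) monoid" Mob mob by (rule mob_hom)
  have "kernel SL Mob mob = group_center (SL :: ('f^2^2) monoid)"
    using mob_eq_id_iff by (auto simp: kernel_def SL_def Mob_def group_center_def)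
  moreover have "mob ` carrier SL = carrier (Mob :: ('f option \<Rightarrow> 'f option) monoid)"
    by (simp add: SL_def Mob_def)
  ultimately show ?thesis
    using FactGroup_iso_set by (auto simp: is_iso_def L2_def PSL_def)
qed

context field13
begin

text \<open>If the lower left entry \<open>c\<close> is nonzero then \<open>a\<close> and \<open>d\<close> are free and \<open>b\<close> is determined; if it vanishes then
  \<open>a\<close> determines \<open>d\<close> and \<open>b\<close> is free.\<close>
lemma card_SL: "card {A :: 'f^2^2. det A = 1} = 2184"
proof -
  let ?N = "UNIV - {0 :: 'f}"
  let ?f = "\<lambda>(a, c, d). mat2 a ((a * d - 1) / c) c d" and ?g = "\<lambda>(a, b). mat2 a b 0 (1 / a)"
  let ?S = "{A :: 'f^2^2. det A = 1}"
  have N: "card ?N = 12" using card13 by (simp add: card_Diff_subset)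
  have "?S = ?f ` (UNIV \<times> ?N \<times> UNIV) \<union> ?g ` (?N \<times> UNIV)"
  proof (intro equalityI subsetI)
    fix A :: "'f^2^2" assume A: "A \<in> ?S"
    obtain a b c d where A2: "A = mat2 a b c d" using mat2_collapse[of A] by metis
    have d: "a * d - b * c = 1" using A by (simp add: A2 det_mat2)
    show "A \<in> ?f ` (UNIV \<times> ?N \<times> UNIV) \<union> ?g ` (?N \<times> UNIV)"
    proof (cases "c = 0")
      case True
      then have "a \<noteq> 0" "d = 1 / a" using d by (auto simp: eq_divide_eq mult.commute)
      then have "A = ?g (a, b)" "(a, b) \<in> ?N \<times> UNIV" using True by (simp_all add: A2)
      then show ?thesis by blast
    next
      case False
      then have "b = (a * d - 1) / c" using d by (simp add: field_simps)
      then have "A = ?f (a, c, d)" "(a, c, d) \<in> UNIV \<times> ?N \<times> UNIV" using False by (simp_all add: A2)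
      then show ?thesis by blast
    qed
  qed (auto simp: det_mat2 split: if_splits)
  moreover have "inj_on ?f (UNIV \<times> ?N \<times> UNIV)" "inj_on ?g (?N \<times> UNIV)"
    by (auto simp: inj_on_def mat2_eq_iff)
  then have "card (?f ` (UNIV \<times> ?N \<times> UNIV)) = 2028" "card (?g ` (?N \<times> UNIV)) = 156"
    using N card13 by (simp_all add: card_image card_cartesian_product)
  moreover have "?f ` (UNIV \<times> ?N \<times> UNIV) \<inter> ?g ` (?N \<times> UNIV) = {}"
    by (auto simp: mat2_eq_iff)
  ultimately show ?thesis by (simp add: card_Un_disjoint)
qed

lemma center_SL: "group_center (SL :: ('f^2^2) monoid) = {mat2 1 0 0 1, mat2 (-1) 0 0 (-1)}"
proof (intro equalityI subsetI)
  fix A :: "'f^2^2" assume A: "A \<in> group_center SL"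
  obtain a b c d where A2: "A = mat2 a b c d" using mat2_collapse[of A] by metis
  have det: "det A = 1" using A by (simp add: group_center_def SL_def)
  then have "mob A = id" using mob_eq_id_iff A by blast
  then have "mob A None = None" "mob A (Some 0) = Some 0" "mob A (Some 1) = Some 1" by simp_all
  then have *: "c = 0" "b = 0" "a = d"
    using det by (auto simp: A2 det_mat2 mob_mat2_None mob_mat2_Some split: if_splits)
  then have "d * d = 1" using det by (simp add: A2 det_mat2)
  then have "d = 1 \<or> d = - 1" by (simp add: square_eq_1_iff)
  then show "A \<in> {mat2 1 0 0 1, mat2 (-1) 0 0 (-1)}" using * by (auto simp: A2)
qed (auto simp: group_center_def SL_def det_2 mat2_eq_iff matrix_matrix_mult_def sum_2)

lemma one_neq_minus_one: "(1 :: 'f) \<noteq> - 1"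
proof
  assume "(1 :: 'f) = - 1"
  then have "(2 :: 'f) = 0" by (metis add.right_inverse one_add_one)
  then show False by (simp add: numeral_eq13)
qed

lemma order_L2: "order (L2 TYPE('f)) = 1092"
proof -
  interpret SL: group "SL :: ('f^2^2) monoid" by (rule group_SL)
  have "card (group_center (SL :: ('f^2^2) monoid)) = 2"
    using one_neq_minus_one by (simp add: center_SL mat2_eq_iff)
  moreover have "order (SL :: ('f^2^2) monoid) = 2184" using card_SL by (simp add: order_def SL_def)
  ultimately show ?thesis
    using SL.lagrange[OF normal_imp_subgroup[OF normal_group_center[OF group_SL]]]
    by (simp add: L2_def PSL_def FactGroup_def order_def)
qed

lemma order_Mob: "order (Mob :: ('f option \<Rightarrow> 'f option) monoid) = 1092"
proof -
  obtain h where "h \<in> iso (L2 TYPE('f)) (Mob :: ('f option \<Rightarrow> 'f option) monoid)"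
    using L2_iso_Mob by (auto simp: is_iso_def)
  then show ?thesis using order_L2 iso_same_order by metis
qed

end

section \<open>The action on fourteen points\<close>

lemma pow13_mod7:
  assumes "(k::nat) ^ 13 mod 7 = 1"
  shows "k mod 7 = 1"
proof -
  obtain r where r: "r = k mod 7" by blast
  then have "r \<in> {0,1,2,3,4,5,6}" by (simp; presburger)
  moreover have "r ^ 13 mod 7 = 1" using assms unfolding r by (simp only: power_mod)
  ultimately have "r = 1" by auto
  then show ?thesis using r by simp
qed

text \<open>The remaining case: \<open>powers x\<close> is its own centralizer and is not normal, as the element \<open>w\<close> shows. The choice of
  \<open>w\<close> fixes the labelling of the cosets of the normalizer.\<close>
locale self_centralizing13 = group1092 G ty x
  for G :: "('a, 'b) monoid_scheme" (structure) and ty :: "'f::field itself" and x +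
  fixes w :: 'a
  assumes w_carrier [simp]: "w \<in> carrier G"
    and w_notin: "w \<notin> normalizer x"
    and centralizer_eq: "centralizer x = powers x"
begin

lemma card_normalizer_78: "card (normalizer x) = 78"
  using card_normalizer w_notin w_carrier by blast

lemma card_centralizer_13: "card (centralizer x) = 13"
  by (simp add: centralizer_eq card_powers fin ord_x)

lemma multiplier_image: "multiplier ` normalizer x = Sq"
  using card_multiplier_image card_normalizer_78 card_centralizer_13 closed_card6[OF multiplier_image_closed] by simp

lemma multiplier_one_iff: "n \<in> normalizer x \<Longrightarrow> multiplier n = 1 \<longleftrightarrow> n \<in> powers x"
  using multiplier_eq_one_iff centralizer_eq by simp

text \<open>The count of double cosets leaves the orders 14 and 1092. In the second case \<open>x\<close> would act on \<open>powers y\<close> by an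
  automorphism whose order divides both 13 and 6, hence trivially, and \<open>y\<close> would lie in the centralizer of
  \<open>x\<close>.\<close>
lemma card_normalizer_7:
  assumes y: "y \<in> carrier G" "ord y = 7"
  shows "card (normalizer y) = 14"
proof -
  have p7: "prime (7::nat)" by (simp add: prime_nat_numeral_eq)
  have fac: "order G = 7 * 156" "\<not> 7 dvd (156::nat)" by (simp_all add: order_G)
  obtain d where d: "card (normalizer y) = 7 * d" "d dvd 156" "\<not> 7 dvd d"
    using card_normalizer_factor[OF fin y p7 fac] by blast
  have "7 * (7 * d) dvd 7 * 156 - 7 * d"
    using double_coset_dvd[OF fin y p7 fac] d order_G by simp
  then have "7 * (7 * d) dvd 7 * (156 - d)" by (simp add: right_diff_distrib')
  then have "7 * d dvd 156 - d" by (simp only: nat_mult_dvd_cancel1[of 7] zero_less_numeral)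
  then have 7: "7 dvd 156 - d" by (metis dvd_mult_left)
  have "d \<le> 156" using d(2) by (simp add: dvd_imp_le)
  obtain q where q: "156 - d = 7 * q" using 7 by (auto simp: dvd_def)
  then have dq: "d = 156 - 7 * q" and "q \<le> 22" using \<open>d \<le> 156\<close> by auto
  have "q \<in> set [0..<23]" using \<open>q \<le> 22\<close> by simp
  then have "q \<in> {0,1,2,3,4,5,6,7,8,9,10,11,12,13,14,15,16,17,18,19,20,21,22}" by (simp add: upt_rec numeral_eq_Suc)
  then have "d = 2 \<or> d = 156" using d(2) unfolding dq by (elim insertE) simp_all
  moreover have "d \<noteq> 156"
  proof
    assume "d = 156"
    then have "card (normalizer y) = card (carrier G)" using d(1) order_G by (simp add: order_def)
    then have "normalizer y = carrier G"
      using card_subset_eq[OF fin] normalizer_subgroup[OF fin y(1)] subgroup.subset by blast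
    then have "x \<in> normalizer y" by simp
    then have "x \<otimes> y \<otimes> inv x \<in> powers y" by (simp add: normalizer_def)
    then obtain k :: nat where k: "x \<otimes> y \<otimes> inv x = y [^] k" by (auto simp: mem_powers)
    have iter: "x [^] i \<otimes> y \<otimes> inv (x [^] i) = y [^] (k ^ i)" for i :: nat
    proof (induction i)
      case (Suc i)
      have "x [^] Suc i \<otimes> y \<otimes> inv (x [^] Suc i) = x [^] i \<otimes> (x \<otimes> y \<otimes> inv x) \<otimes> inv (x [^] i)"
        using y by (simp add: conj_conj)
      also have "\<dots> = (x [^] i \<otimes> y \<otimes> inv (x [^] i)) [^] k" using y by (simp add: k conj_pow)
      also have "\<dots> = y [^] (k ^ Suc i)" unfolding Suc using y by (simp add: nat_pow_pow mult.commute)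
      finally show ?case .
    qed (use y in simp)
    have "y [^] (k ^ 13) = y [^] (1::nat)" using iter[of 13] pow_ord_eq_1[OF x_carrier] y by (simp add: ord_x)
    then have "k ^ 13 mod 7 = 1" using y by (subst (asm) pow_eq_mod) simp_all
    then have "k mod 7 = 1" by (rule pow13_mod7)
    then have "y [^] k = y [^] (1::nat)" using y by (subst pow_eq_mod) simp_all
    then have "x \<otimes> y = y \<otimes> x" using k y conj_eq_self_iff[of x y] by simp
    then have "y \<otimes> x = x \<otimes> y" by (rule sym)
    then have "y \<in> centralizer x" using y(1) unfolding centralizer_def by blast
    then have yP: "y \<in> powers x" using centralizer_eq by simp
    moreover have "y \<noteq> \<one>" using y by auto
    ultimately show False using ord_in_powers_prime[OF fin x_carrier] prime13 y by (auto simp: ord_x)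
  qed
  ultimately show ?thesis using d by simp
qed

lemma card_ord7: "468 \<le> card {g \<in> carrier G. ord g = 7}"
proof -
  have p7: "prime (7::nat)" by (simp add: prime_nat_numeral_eq)
  obtain y where y: "y \<in> carrier G" "ord y = 7"
    using Cauchy[OF fin p7] order_G by auto
  let ?Y = "powers y - {\<one>}"
  have YG: "?Y \<subseteq> carrier G" using y by (auto simp: mem_powers)
  have P: "subgroup (powers y) G" using powers_subgroup[OF fin y(1)] .
  have "card ?Y = 6" using y subgroup_finite[OF fin P] P
    by (simp add: card_Diff_subset subgroup.one_closed card_powers fin)
  moreover have "order G * card ?Y \<le> card (conjugates ?Y) * card (normalizer y)"
    by (rule card_conjugates[OF fin YG]) (use normalizerI_prime[OF fin y(1)] y p7 in \<open>auto simp: normalizer_def\<close>)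
  ultimately have "468 \<le> card (conjugates ?Y)" using order_G card_normalizer_7[OF y] by simp
  moreover have sub: "conjugates ?Y \<subseteq> {g \<in> carrier G. ord g = 7}"
    using ord_conjugates[OF YG] conjugates_subset[OF YG] ord_in_powers_prime[OF fin y(1)] y p7 by fastforce
  then have "card (conjugates ?Y) \<le> card {g \<in> carrier G. ord g = 7}" using fin by (intro card_mono) auto
  ultimately show ?thesis by linarith
qed

lemma card_ord13: "168 \<le> card {g \<in> carrier G. ord g = 13}"
proof -
  let ?Y = "powers x - {\<one>}"
  have YG: "?Y \<subseteq> carrier G" by (auto simp: mem_powers)
  have P: "subgroup (powers x) G" using powers_subgroup[OF fin x_carrier] .
  have "card ?Y = 12" using subgroup_finite[OF fin P] P
    by (simp add: card_Diff_subset subgroup.one_closed card_powers fin ord_x)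
  moreover have "order G * card ?Y \<le> card (conjugates ?Y) * card (normalizer x)"
    by (rule card_conjugates[OF fin YG]) (use normalizerI_prime[OF fin x_carrier] prime13 in \<open>auto simp: normalizer_def ord_x\<close>)
  ultimately have "168 \<le> card (conjugates ?Y)" using order_G card_normalizer_78 by simp
  moreover have sub: "conjugates ?Y \<subseteq> {g \<in> carrier G. ord g = 13}"
    using ord_conjugates[OF YG] conjugates_subset[OF YG] ord_in_powers_prime[OF fin x_carrier] ord_x prime13 by fastforce
  then have "card (conjugates ?Y) \<le> card {g \<in> carrier G. ord g = 13}" using fin by (intro card_mono) auto
  ultimately show ?thesis by linarith
qed

text \<open>Representatives of the left cosets of the normalizer. The single double coset outside the normalizer makes the
  cosets of \<open>X b \<otimes> w\<close>, for \<open>b\<close> in the field, all the other ones.\<close>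
fun base :: "'f option \<Rightarrow> 'a"
  where "base None = \<one>" | "base (Some b) = X b \<otimes> w"

lemma base_carrier [simp]: "base p \<in> carrier G" by (cases p) simp_all

lemma mult_N: "n \<in> normalizer x \<Longrightarrow> m \<in> normalizer x \<Longrightarrow> n \<otimes> m \<in> normalizer x" using N_sub by (simp add: subgroup.m_closed)

lemma base_cover:
  assumes g: "g \<in> carrier G"
  shows "\<exists>p. \<exists>n\<in>normalizer x. g = base p \<otimes> n"
proof (cases "g \<in> normalizer x")
  case True
  then show ?thesis by (intro exI[of _ None] bexI[of _ g]) (use g in simp_all)
next
  case False
  let ?f = "\<lambda>(y, n). y \<otimes> w \<otimes> n"
  have sub: "?f ` (powers x \<times> normalizer x) \<subseteq> carrier G - normalizer x"
    using double_coset_outside[OF fin x_carrier] w_notin by auto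
  have "card (?f ` (powers x \<times> normalizer x)) = 13 * 78"
    using double_coset_injective[OF fin x_carrier ord_x prime13 order_factor w_carrier w_notin]
    by (simp add: card_image card_cartesian_product card_powers fin ord_x card_normalizer_78)
  also have "\<dots> = card (carrier G - normalizer x)"
    using order_G subgroup_finite(1)[OF fin N_sub] subgroup.subset[OF N_sub]
    by (simp add: card_Diff_subset card_normalizer_78 order_def)
  finally have "?f ` (powers x \<times> normalizer x) = carrier G - normalizer x"
    using sub fin by (intro card_subset_eq) auto
  then have "g \<in> ?f ` (powers x \<times> normalizer x)" using False g by simp
  then obtain y n where "y \<in> powers x" "n \<in> normalizer x" "g = y \<otimes> w \<otimes> n" by auto
  moreover from this obtain b where "y = X b" using range_X by blast
  ultimately show ?thesis by (intro exI[of _ "Some b"]) auto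
qed

lemma base_unique:
  assumes "n \<in> normalizer x" "m \<in> normalizer x" "base p \<otimes> n = base q \<otimes> m"
  shows "p = q"
proof -
  have out: "base (Some b) \<otimes> k \<notin> normalizer x" if "k \<in> normalizer x" for b k
    using double_coset_outside[OF fin x_carrier, of w "X b" k] that w_notin by auto
  show ?thesis
  proof (cases p; cases q)
    fix b c assume pq: "p = Some b" "q = Some c"
    have "(X b, n) = (X c, m)"
      by (rule inj_onD[OF double_coset_injective[OF fin x_carrier ord_x prime13 order_factor w_carrier w_notin]])
        (use assms pq in auto)
    then show ?thesis using pq by simp
  next
    fix b assume "p = Some b" "q = None"
    then show ?thesis using out[OF assms(1), of b] assms N_carrier by simp
  next
    fix b assume "p = None" "q = Some b"
    then show ?thesis using out[OF assms(2), of b] assms N_carrier by simp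
  qed simp
qed

definition loc :: "'a \<Rightarrow> 'f option"
  where "loc g = (THE p. \<exists>n\<in>normalizer x. g = base p \<otimes> n)"

lemma loc_eq: "n \<in> normalizer x \<Longrightarrow> g = base p \<otimes> n \<Longrightarrow> loc g = p"
  unfolding loc_def using base_unique by (intro the_equality) blast+

lemma loc_ex: "g \<in> carrier G \<Longrightarrow> \<exists>n\<in>normalizer x. g = base (loc g) \<otimes> n"
  using base_cover loc_eq by metis

definition act :: "'a \<Rightarrow> 'f option \<Rightarrow> 'f option"
  where "act g p = loc (g \<otimes> base p)"

lemma act_eqI: "n \<in> normalizer x \<Longrightarrow> g \<otimes> base p = base q \<otimes> n \<Longrightarrow> act g p = q"
  unfolding act_def by (rule loc_eq)

lemma act_ex: "g \<in> carrier G \<Longrightarrow> \<exists>n\<in>normalizer x. g \<otimes> base p = base (act g p) \<otimes> n"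
  unfolding act_def by (intro loc_ex) simp

lemma act_mult:
  assumes g: "g \<in> carrier G" and h: "h \<in> carrier G"
  shows "act (g \<otimes> h) p = act g (act h p)"
proof -
  obtain n where n: "n \<in> normalizer x" "h \<otimes> base p = base (act h p) \<otimes> n" using act_ex[OF h] by blast
  obtain m where m: "m \<in> normalizer x" "g \<otimes> base (act h p) = base (act g (act h p)) \<otimes> m" using act_ex[OF g] by blast
  have nm: "n \<in> carrier G" "m \<in> carrier G" using n m N_carrier by auto
  have "(g \<otimes> h) \<otimes> base p = g \<otimes> base (act h p) \<otimes> n" using g h nm by (simp add: m_assoc n(2))
  also have "\<dots> = base (act g (act h p)) \<otimes> (m \<otimes> n)" unfolding m(2) using nm by (simp add: m_assoc)
  finally show ?thesis using act_eqI mult_N n(1) m(1) by blast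
qed

lemma act_one [simp]: "act \<one> p = p"
  using one_N by (intro act_eqI[of \<one>]) simp_all

lemma act_inv: "g \<in> carrier G \<Longrightarrow> act (inv g) (act g p) = p" "g \<in> carrier G \<Longrightarrow> act g (act (inv g) p) = p"
  by (simp_all flip: act_mult)

lemma act_inj: "g \<in> carrier G \<Longrightarrow> act g p = act g q \<longleftrightarrow> p = q"
  using act_inv(1) by metis

lemma act_None_iff: "g \<in> carrier G \<Longrightarrow> act g None = None \<longleftrightarrow> g \<in> normalizer x"
  using act_ex[of g None] act_eqI[of g g None None] by (auto simp: N_carrier)

lemma act_X [simp]: "act (X b) None = None" "act (X b) (Some c) = Some (b + c)"
  using one_N by (auto simp: act_None_iff X_add m_assoc intro!: act_eqI[of \<one>])

lemma act_w: "act w None = Some 0"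
  using one_N by (intro act_eqI[of \<one>]) simp_all

lemma act_N:
  assumes n: "n \<in> normalizer x"
  shows "\<exists>c. \<forall>b. act n (Some b) = Some (multiplier n * b + c)"
proof -
  have nG: "n \<in> carrier G" using n by (rule N_carrier)
  have "act n None = None" using n nG act_None_iff by blast
  then have "act n (Some 0) \<noteq> None" using act_inj[OF nG, of "Some 0" None] by auto
  then obtain c where c: "act n (Some 0) = Some c" by blast
  have "act n (Some b) = Some (multiplier n * b + c)" for b
  proof -
    have *: "n \<otimes> X b = X (multiplier n * b) \<otimes> n" using X_conj[OF n, of b] nG by (metis X_carrier inv_solve_right' m_closed)
    have "act n (Some b) = act (n \<otimes> X b) (Some 0)" using nG by (simp add: act_mult)
    also have "\<dots> = Some (multiplier n * b + c)" unfolding * using nG by (simp add: act_mult c)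
    finally show ?thesis .
  qed
  then show ?thesis by blast
qed

text \<open>An affine map with two fixed points is the identity, and the only translation with a fixed point is the trivial
  one.\<close>
lemma fixes_two_finite_points:
  assumes g: "g \<in> carrier G" "act g None = None" "act g (Some b) = Some b" "act g (Some c) = Some c" "b \<noteq> c"
  shows "g = \<one>"
proof -
  have n: "g \<in> normalizer x" using g act_None_iff by blast
  obtain d where d: "\<And>b. act g (Some b) = Some (multiplier g * b + d)" using act_N[OF n] by blast
  have bc: "multiplier g * b + d = b" "multiplier g * c + d = c" using d g by auto
  then have "multiplier g * b - multiplier g * c = b - c" by (metis add_diff_cancel_right)
  then have "(multiplier g - 1) * (b - c) = 0" by (simp add: algebra_simps)
  then have "multiplier g = 1" using g(5) by simp
  moreover from this have "d = 0" using bc by simp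
  ultimately obtain a where a: "g = X a" using multiplier_one_iff[OF n] range_X by blast
  have "a = 0" using g(3) unfolding a by simp
  then show ?thesis using a by simp
qed

lemma transitive: "\<exists>g\<in>carrier G. act g None = p"
proof (cases p)
  case None
  then show ?thesis by (intro bexI[of _ \<one>]) simp_all
next
  case (Some b)
  then show ?thesis by (intro bexI[of _ "X b \<otimes> w"]) (simp_all add: act_mult act_w)
qed

text \<open>By transitivity one of the points may be moved to infinity.\<close>
lemma fixes_three_points:
  assumes g: "g \<in> carrier G" "act g p = p" "act g q = q" "act g r = r" "p \<noteq> q" "p \<noteq> r" "q \<noteq> r"
  shows "g = \<one>"
proof -
  obtain k where k: "k \<in> carrier G" "act k None = p" using transitive by blast
  let ?g = "inv k \<otimes> g \<otimes> inv (inv k)"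
  have kp: "act (inv k) p = None" using k act_inv(1)[of k None] by simp
  have "act (inv k) q \<noteq> None" "act (inv k) r \<noteq> None" "act (inv k) q \<noteq> act (inv k) r"
    using g kp k act_inj[of "inv k"] by (metis inv_closed)+
  then obtain b c where bc: "act (inv k) q = Some b" "act (inv k) r = Some c" "b \<noteq> c" by auto
  have fx: "act ?g (act (inv k) s) = act (inv k) s" if "act g s = s" for s
    using k g that by (simp add: act_mult act_inv)
  have "?g = \<one>"
    using fx[OF g(2)] fx[OF g(3)] fx[OF g(4)] bc kp k g(1) by (intro fixes_two_finite_points[of ?g b c]) auto
  then show ?thesis using k g(1) conj_eq_one_iff[of "inv k" g] by simp
qed

lemma act_faithful:
  assumes g: "g \<in> carrier G" "h \<in> carrier G" "act g = act h"
  shows "g = h"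
proof -
  have "act (inv g \<otimes> h) p = p" for p using g by (simp add: act_mult act_inv flip: g(3))
  then have "inv g \<otimes> h = \<one>"
    by (intro fixes_three_points[of _ None "Some 0" "Some 1"]) (use g in auto)
  then show ?thesis using g by (metis inv_closed inv_equality inv_inv)
qed

text \<open>The stabilizer of infinity and 0, which acts by multiplication with the squares.\<close>
definition H :: "'a set" where "H = {g \<in> carrier G. act g None = None \<and> act g (Some 0) = Some 0}"

lemma H_carrier: "g \<in> H \<Longrightarrow> g \<in> carrier G" by (simp add: H_def)
lemma H_N: "g \<in> H \<Longrightarrow> g \<in> normalizer x" using act_None_iff by (auto simp: H_def)

lemma act_H: "g \<in> H \<Longrightarrow> act g (Some b) = Some (multiplier g * b)"
  using act_N[OF H_N, of g] by (auto simp: H_def)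

lemma H_mult: "g \<in> H \<Longrightarrow> h \<in> H \<Longrightarrow> g \<otimes> h \<in> H" by (simp add: H_def act_mult)

lemma H_pow: "g \<in> H \<Longrightarrow> g [^] (k::nat) \<in> H"
  by (induction k) (simp_all add: H_mult, simp add: H_def)

lemma H_eq_one_iff: "g \<in> H \<Longrightarrow> g = \<one> \<longleftrightarrow> multiplier g = 1"
  using fixes_two_finite_points[of g 0 1] act_H[of g 1] by (auto simp: H_def)

lemma H_pow_eq_one: "g \<in> H \<Longrightarrow> g [^] (k::nat) = \<one> \<longleftrightarrow> multiplier g ^ k = 1"
  using H_eq_one_iff[OF H_pow] multiplier_pow[OF H_N] by simp

lemma H_inj: "inj_on multiplier H"
proof (rule inj_onI)
  fix g h assume gh: "g \<in> H" "h \<in> H" "multiplier g = multiplier h"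
  have "act g = act h"
  proof
    fix p show "act g p = act h p"
    proof (cases p)
      case None
      then show ?thesis using gh(1,2) by (simp add: H_def)
    next
      case (Some b)
      then show ?thesis using act_H[OF gh(1)] act_H[OF gh(2)] gh(3) by simp
    qed
  qed
  then show "g = h" using act_faithful gh H_carrier by blast
qed

lemma H_image: "multiplier ` H = Sq"
proof
  show "multiplier ` H \<subseteq> Sq" using H_N multiplier_image by blast
  show "Sq \<subseteq> multiplier ` H"
  proof
    fix a assume "a \<in> Sq"
    then have "a \<in> multiplier ` normalizer x" by (simp only: multiplier_image)
    then obtain n where n: "n \<in> normalizer x" "multiplier n = a" by blast
    obtain c where c: "\<And>b. act n (Some b) = Some (multiplier n * b + c)" using act_N[OF n(1)] by blast
    have nG: "n \<in> carrier G" using n by (simp add: N_carrier)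
    have "X (- c) \<otimes> n \<in> H" using nG n(1) act_None_iff[OF nG] by (simp add: H_def act_mult c)
    moreover have "multiplier (X (- c)) = 1" using multiplier_one_iff X_N X_in_powers by blast
    then have "multiplier (X (- c) \<otimes> n) = a" using n by (simp add: multiplier_mult)
    ultimately show "a \<in> multiplier ` H" by blast
  qed
qed

lemma card_H: "card H = 6"
  using card_image[OF H_inj] by (simp add: H_image card_Sq)

end

section \<open>Counting elements by their order\<close>

context field13
begin

text \<open>A rewrite rule for numerals; the premise keeps it from applying to numerals below 13 over and over.\<close>
lemma reduce13: "(13::nat) \<le> numeral n \<Longrightarrow> (numeral n :: 'f) = of_nat (numeral n mod 13)"
proof -
  have "(of_nat (numeral n) :: 'f) = of_nat (numeral n mod 13)" unfolding of_nat_eq13 by (rule mod_mod_trivial[symmetric])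
  then show ?thesis by (simp only: of_nat_numeral)
qed

lemma pow2_13: "(b :: 'f) ^ 2 = 1 \<Longrightarrow> b = 1 \<or> b = 12"
  using cases13[of b] by (auto simp: numeral_eq13)

lemma pow3_13: "(b :: 'f) ^ 3 = 1 \<Longrightarrow> b = 1 \<or> b = 3 \<or> b = 9"
  using cases13[of b] by (auto simp: numeral_eq13)

lemma twelve: "(12 :: 'f) = - 1"
proof -
  have "(12 :: 'f) + 1 = 0" by (simp add: numeral_eq13)
  then show ?thesis by (simp only: eq_neg_iff_add_eq_0)
qed

lemma Sq_square: "a \<in> Sq \<Longrightarrow> \<exists>t. t \<noteq> 0 \<and> a = t * t"
proof -
  assume "a \<in> Sq"
  then have "a = 1 * 1 \<or> a = 4 * 4 \<or> a = 2 * 2 \<or> a = 3 * 3 \<or> a = 6 * 6 \<or> a = 5 * 5"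
    by (auto simp: Sq_def numeral_eq13)
  then show ?thesis by (elim disjE) (rule exI, rule conjI[rotated], assumption, simp add: numeral_eq13)+
qed

text \<open>The values of \<open>V\<close> on the squares are determined by \<open>V 1\<close>, and on the other elements by \<open>e = V 2\<close>, which is
  not a square because \<open>V\<close> is injective and maps the squares onto themselves. Of the six possible values of \<open>e\<close>
  only 6 satisfies \<open>rel\<close>, a relation that holds for \<open>V z = -1 / z\<close> because the map \<open>z \<mapsto> 1 - 1 / z\<close> has order
  3.\<close>
lemma neg_inverse_unique:
  fixes V :: "'f \<Rightarrow> 'f"
  assumes V1: "V 1 = 12" and V3: "\<And>b. b \<noteq> 0 \<Longrightarrow> V (3 * b) = 9 * V b"
    and V12: "\<And>b. b \<noteq> 0 \<Longrightarrow> V (12 * b) = 12 * V b"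
    and inj: "\<And>b c. b \<noteq> 0 \<Longrightarrow> c \<noteq> 0 \<Longrightarrow> V b = V c \<Longrightarrow> b = c"
    and nz: "\<And>b. b \<noteq> 0 \<Longrightarrow> V b \<noteq> 0"
    and rel: "V (V (V 2 + 1) + 1) + 1 = 2"
    and b: "b \<noteq> 0"
  shows "b * V b = 12"
proof -
  define e where "e = V 2"
  have v1: "V 3 = 4" using V3[of 1] by (simp add: V1 reduce13)
  have v2: "V 9 = 10" using V3[of 3] by (simp add: v1 reduce13 numeral_eq13)
  have v3: "V 12 = 1" using V12[of 1] by (simp add: V1 reduce13)
  have v4: "V 10 = 9" using V3[of 12] by (simp add: v3 reduce13 numeral_eq13)
  have v5: "V 4 = 3" using V3[of 10] by (simp add: v4 reduce13 numeral_eq13)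
  have w1: "V 6 = 9 * e" using V3[of 2] by (simp add: e_def numeral_eq13)
  have w2: "V 5 = 3 * e" using V3[of 6] by (simp add: w1 reduce13 numeral_eq13)
  have w3: "V 11 = 12 * e" using V12[of 2] by (simp add: e_def reduce13 numeral_eq13)
  have w4: "V 7 = 4 * e" using V12[of 6] by (simp add: w1 reduce13 numeral_eq13)
  have w5: "V 8 = 10 * e" using V12[of 5] by (simp add: w2 reduce13 numeral_eq13)
  have ne: "e \<noteq> V c" if "c \<noteq> 0" "c \<noteq> 2" for c
    using inj[of 2 c] that by (auto simp: e_def numeral_eq13)
  have "e \<noteq> 12" "e \<noteq> 4" "e \<noteq> 10" "e \<noteq> 1" "e \<noteq> 9" "e \<noteq> 3"
    using ne[of 1] ne[of 3] ne[of 9] ne[of 12] ne[of 10] ne[of 4]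
    by (simp_all add: V1 v1 v2 v3 v4 v5 numeral_eq13)
  moreover have "e \<noteq> 0" using nz[of 2] by (simp add: e_def numeral_eq13)
  ultimately have e_cases: "e = 2 \<or> e = 5 \<or> e = 6 \<or> e = 7 \<or> e = 8 \<or> e = 11" using cases13[of e] by simp
  have rel: "V (V (e + 1) + 1) + 1 = 2" using rel by (simp add: e_def)
  have "e \<noteq> 2"
  proof
    assume e: "e = 2"
    have "V (e + 1) = 4" using v1 by (simp add: e)
    then have "V (V (e + 1) + 1) = 6" using w2 by (simp add: e)
    then show False using rel by (simp add: numeral_eq13)
  qed
  moreover have "e \<noteq> 5"
  proof
    assume e: "e = 5"
    have "V (e + 1) = 6" using w1 by (simp add: e numeral_eq13)
    then have "V (V (e + 1) + 1) = 7" using w4 by (simp add: e numeral_eq13)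
    then show False using rel by (simp add: numeral_eq13)
  qed
  moreover have "e \<noteq> 7"
  proof
    assume e: "e = 7"
    have "V (e + 1) = 5" using w5 by (simp add: e numeral_eq13)
    then have "V (V (e + 1) + 1) = 11" using w1 by (simp add: e numeral_eq13)
    then show False using rel by (simp add: numeral_eq13)
  qed
  moreover have "e \<noteq> 8"
  proof
    assume e: "e = 8"
    have "V (e + 1) = 10" using v2 by (simp add: e)
    then have "V (V (e + 1) + 1) = 5" using w3 by (simp add: e numeral_eq13)
    then show False using rel by (simp add: numeral_eq13)
  qed
  moreover have "e \<noteq> 11"
  proof
    assume e: "e = 11"
    have "V (e + 1) = 1" using v3 by (simp add: e)
    then have "V (V (e + 1) + 1) = 11" by (simp add: e flip: e_def)
    then show False using rel by (simp add: numeral_eq13)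
  qed
  ultimately have e6: "e = 6" using e_cases by blast
  then have "V 2 = 6" by (simp add: e_def)
  then show ?thesis using cases13[of b] b
    by (auto simp: v1 v2 v3 v4 v5 w1 w2 w3 w4 w5 V1 e6 numeral_eq13)
qed

end

context self_centralizing13
begin

lemma H_fixed: "h \<in> H \<Longrightarrow> h \<noteq> \<one> \<Longrightarrow> act h p = p \<Longrightarrow> p = None \<or> p = Some 0"
  using act_H[of h] H_eq_one_iff[of h] by (cases p) auto

definition Swap :: "'a set"
  where "Swap = {g \<in> carrier G. act g None = Some 0 \<and> act g (Some 0) = None}"

lemma card_H_Swap: "card (H \<union> Swap) \<le> 12"
proof -
  have finH: "finite H" using card_H by (metis card.infinite zero_neq_numeral)
  have "card Swap \<le> card H"
  proof (cases "Swap = {}")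
    case False
    then obtain g where g: "g \<in> Swap" by blast
    have gG: "g \<in> carrier G" using g by (simp add: Swap_def)
    have "Swap \<subseteq> (\<lambda>h. g \<otimes> h) ` H"
    proof
      fix k assume k: "k \<in> Swap"
      then have kG: "k \<in> carrier G" by (simp add: Swap_def)
      have "act (inv g) (Some 0) = None" "act (inv g) None = Some 0"
        using act_inv(1)[OF gG, of None] act_inv(1)[OF gG, of "Some 0"] g by (simp_all add: Swap_def)
      then have "inv g \<otimes> k \<in> H" using k kG gG by (simp add: H_def Swap_def act_mult)
      moreover have "k = g \<otimes> (inv g \<otimes> k)" using kG gG by (simp add: inv_mult_cancel)
      ultimately show "k \<in> (\<lambda>h. g \<otimes> h) ` H" by blast
    qed
    then show ?thesis using finH by (meson card_image_le card_mono finite_imageI le_trans)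
  qed simp
  then show ?thesis using card_Un_le[of H Swap] card_H by linarith
qed

text \<open>A nontrivial element of \<open>H\<close> fixes only infinity and 0, so an element that conjugates it into \<open>H\<close> maps this pair
  of points to itself; there are at most 12 such elements.\<close>
lemma card_conjugates_H:
  assumes Y: "Y \<subseteq> H - {\<one>}"
  shows "91 * card Y \<le> card (conjugates Y)"
proof -
  have "order G * card Y \<le> card (conjugates Y) * card (H \<union> Swap)"
  proof (rule card_conjugates[OF fin])
    fix g y assume g: "g \<in> carrier G" and y: "y \<in> Y" "g \<otimes> y \<otimes> inv g \<in> Y"
    let ?z = "g \<otimes> y \<otimes> inv g"
    have yH: "y \<in> H" and yG: "y \<in> carrier G" using y Y H_carrier by auto
    have zH: "?z \<in> H" "?z \<noteq> \<one>" using y Y by auto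
    have "act g p = None \<or> act g p = Some 0" if "act y p = p" for p
    proof (rule H_fixed[OF zH])
      show "act ?z (act g p) = act g p" using g yG that by (simp add: act_mult act_inv)
    qed
    then have "act g None = None \<or> act g None = Some 0" "act g (Some 0) = None \<or> act g (Some 0) = Some 0"
      using yH by (simp_all add: H_def)
    moreover have "act g None \<noteq> act g (Some 0)" using act_inj[OF g] by simp
    ultimately show "g \<in> H \<union> Swap" using g by (auto simp: H_def Swap_def)
  qed (use Y in \<open>auto simp: H_def Swap_def\<close>)
  also have "\<dots> \<le> card (conjugates Y) * 12" using card_H_Swap by simp
  finally show ?thesis using order_G by simp
qed

definition H_part :: "'f set \<Rightarrow> 'a set"
  where "H_part A = {h \<in> H. multiplier h \<in> A}"

lemma card_H_part: "A \<subseteq> Sq \<Longrightarrow> card (H_part A) = card A"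
proof -
  assume A: "A \<subseteq> Sq"
  have "multiplier ` H_part A = A" using A unfolding H_part_def H_image[symmetric] by auto
  moreover have "inj_on multiplier (H_part A)" using H_inj by (rule inj_on_subset) (auto simp: H_part_def)
  ultimately show ?thesis by (metis card_image)
qed

lemma H_part_subset: "1 \<notin> A \<Longrightarrow> H_part A \<subseteq> H - {\<one>}"
  by (auto simp: H_part_def)

lemma ord_H_part6:
  assumes "h \<in> H_part {4, 10}"
  shows "ord h = 6"
proof -
  have h: "h \<in> H" "multiplier h \<in> {4, 10}" using assms by (auto simp: H_part_def)
  have hG: "h \<in> carrier G" using h by (simp add: H_carrier)
  have "multiplier h ^ ord h = 1" using H_pow_eq_one[OF h(1), of "ord h"] hG by simp
  then have "6 dvd ord h" using four_ten_pow h(2) by blast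
  moreover have "h [^] (6::nat) = \<one>" using h by (subst H_pow_eq_one) (auto simp: pow6_iff Sq_def)
  then have "ord h dvd 6" using hG by (simp add: pow_eq_id)
  ultimately show ?thesis by (simp add: dvd_antisym)
qed

lemma ord_H_part23:
  assumes "h \<in> H_part {3, 9, 12}"
  shows "ord h = 2 \<or> ord h = 3"
proof -
  have h: "h \<in> H" "multiplier h \<in> {3, 9, 12}" using assms by (auto simp: H_part_def)
  have hG: "h \<in> carrier G" using h by (simp add: H_carrier)
  have "h \<noteq> \<one>" using h H_eq_one_iff[OF h(1)] by (auto simp: numeral_eq13)
  moreover have "h [^] (2::nat) = \<one> \<or> h [^] (3::nat) = \<one>"
    using h(2) unfolding H_pow_eq_one[OF h(1)] by (auto simp: numeral_eq13)
  ultimately show ?thesis using ord_prime_if[OF hG] prime3 two_is_prime_nat by blast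
qed

text \<open>The lower bounds 1, 468, 168, 273, 182 for the number of elements of order 1, of order 7, of order 13, of order 2
  or 3, and of order 6 add up to 1092. So each of them is attained, and in the last two cases the elements are
  those conjugate into \<open>H\<close>.\<close>
lemma
  shows orders: "g \<in> carrier G \<Longrightarrow> ord g \<in> {1, 2, 3, 6, 7, 13}"
    and card_ord6: "card {g \<in> carrier G. ord g = 6} = 182"
    and ord_6_conj: "g \<in> carrier G \<Longrightarrow> ord g = 6 \<Longrightarrow> g \<in> conjugates (H_part {4, 10})"
    and ord_23_conj: "g \<in> carrier G \<Longrightarrow> ord g = 2 \<or> ord g = 3 \<Longrightarrow> g \<in> conjugates (H_part {3, 9, 12})"
proof -
  define with_ord where "with_ord D = {g \<in> carrier G. ord g \<in> D}" for D
  have finO: "finite (with_ord D)" for D using fin by (simp add: with_ord_def)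
  let ?C6 = "conjugates (H_part {4, 10})" and ?C23 = "conjugates (H_part {3, 9, 12})"
  have "card (H_part {4, 10}) = 2" by (subst card_H_part) (auto simp: Sq_def numeral_eq13)
  then have c6: "182 \<le> card ?C6"
    using card_conjugates_H[of "H_part {4, 10}"] H_part_subset[of "{4, 10}"] by (simp add: numeral_eq13)
  have "card (H_part {3, 9, 12}) = 3" by (subst card_H_part) (auto simp: Sq_def numeral_eq13)
  then have c23: "273 \<le> card ?C23"
    using card_conjugates_H[of "H_part {3, 9, 12}"] H_part_subset[of "{3, 9, 12}"] by (simp add: numeral_eq13)
  have HG: "H_part A \<subseteq> carrier G" for A using H_carrier by (auto simp: H_part_def)
  have s6: "?C6 \<subseteq> with_ord {6}"
  proof
    fix z assume z: "z \<in> ?C6"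
    then obtain y where "y \<in> H_part {4, 10}" "ord z = ord y" using ord_conjugates[OF HG] by blast
    moreover have "z \<in> carrier G" using z conjugates_subset[OF HG] by blast
    ultimately show "z \<in> with_ord {6}" using ord_H_part6 by (simp add: with_ord_def)
  qed
  have s23: "?C23 \<subseteq> with_ord {2, 3}"
  proof
    fix z assume z: "z \<in> ?C23"
    then obtain y where "y \<in> H_part {3, 9, 12}" "ord z = ord y" using ord_conjugates[OF HG] by blast
    moreover have "z \<in> carrier G" using z conjugates_subset[OF HG] by blast
    ultimately show "z \<in> with_ord {2, 3}" using ord_H_part23[of y] by (simp add: with_ord_def)
  qed
  have O6: "182 \<le> card (with_ord {6})" using c6 card_mono[OF finO s6] by linarith
  have O23: "273 \<le> card (with_ord {2, 3})" using c23 card_mono[OF finO s23] by linarith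
  have O7: "468 \<le> card (with_ord {7})" using card_ord7 by (simp add: with_ord_def)
  have O13: "168 \<le> card (with_ord {13})" using card_ord13 by (simp add: with_ord_def)
  have "with_ord {1} = {\<one>}" using ord_eq_1 by (auto simp: with_ord_def)
  then have O1: "card (with_ord {1}) = 1" by simp
  have un: "with_ord (D \<union> E) = with_ord D \<union> with_ord E" for D E by (auto simp: with_ord_def)
  have add: "card (with_ord (D \<union> E)) = card (with_ord D) + card (with_ord E)" if "D \<inter> E = {}" for D E
  proof -
    have "with_ord D \<inter> with_ord E = {}" using that by (auto simp: with_ord_def)
    then show ?thesis unfolding un using finO by (simp add: card_Un_disjoint)
  qed
  let ?D = "({1} \<union> ({7} \<union> ({13} \<union> ({2, 3} \<union> {6})))) :: nat set"
  have total: "card (with_ord ?D) = 1 + (card (with_ord {7}) + (card (with_ord {13}) + (card (with_ord {2, 3}) + card (with_ord {6}))))"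
    by (subst add, simp)+ (simp only: O1)
  have sub: "with_ord ?D \<subseteq> carrier G" by (auto simp: with_ord_def)
  have "card (with_ord ?D) \<le> 1092" using card_mono[OF fin sub] order_G by (simp add: order_def)
  then have eq: "card (with_ord {6}) = 182" "card (with_ord {2, 3}) = 273" "card (with_ord ?D) = 1092"
    using total O6 O23 O7 O13 by linarith+
  have "with_ord ?D = carrier G" using card_subset_eq[OF fin sub] eq(3) order_G by (simp add: order_def)
  then show "g \<in> carrier G \<Longrightarrow> ord g \<in> {1, 2, 3, 6, 7, 13}" unfolding with_ord_def by blast
  show "card {g \<in> carrier G. ord g = 6} = 182" using eq(1) by (simp add: with_ord_def)
  have "?C6 = with_ord {6}" by (rule card_seteq[OF finO s6]) (use eq c6 in simp)
  then show "g \<in> carrier G \<Longrightarrow> ord g = 6 \<Longrightarrow> g \<in> ?C6" by (simp add: with_ord_def)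
  have "?C23 = with_ord {2, 3}" by (rule card_seteq[OF finO s23]) (use eq c23 in simp)
  then show "g \<in> carrier G \<Longrightarrow> ord g = 2 \<or> ord g = 3 \<Longrightarrow> g \<in> ?C23" by (simp add: with_ord_def)
qed

lemma Omega_rho_1273: "Omega_rho G = 1273"
proof -
  have prime: "prime (7::nat)" by (simp add: prime_nat_numeral_eq)
  have 6: "Omega 6 = 2" using Omega_mult[of 2 3] Omega_prime[OF two_is_prime_nat] Omega_prime[OF prime3] by simp
  have val: "Omega (ord g) = (if g \<in> carrier G - {\<one>} then 1 else 0) + (if g \<in> {g \<in> carrier G. ord g = 6} then 1 else 0)"
    if g: "g \<in> carrier G" for g
    using orders[OF g] g ord_eq_1[OF g] 6 Omega_prime[OF two_is_prime_nat] Omega_prime[OF prime3]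
      Omega_prime[OF prime] Omega_prime[OF prime13] by auto
  have "Omega_rho G = (\<Sum>g\<in>carrier G. Omega (ord g))" using Omega_rho_eq_sum[OF fin] .
  also have "\<dots> = (\<Sum>g\<in>carrier G. (if g \<in> carrier G - {\<one>} then 1 else 0) + (if g \<in> {g \<in> carrier G. ord g = 6} then 1 else 0))"
    by (rule sum.cong[OF refl val])
  also have "\<dots> = (\<Sum>g\<in>carrier G. if g \<in> carrier G - {\<one>} then 1 else 0) + (\<Sum>g\<in>carrier G. if g \<in> {g \<in> carrier G. ord g = 6} then 1 else 0)"
    by (rule sum.distrib)
  also have "(\<Sum>g\<in>carrier G. if g \<in> carrier G - {\<one>} then 1 else 0) = card (carrier G \<inter> (carrier G - {\<one>}))"
    using fin by (simp only: sum.inter_restrict[symmetric] card_eq_sum)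
  also have "carrier G \<inter> (carrier G - {\<one>}) = carrier G - {\<one>}" by blast
  also have "card (carrier G - {\<one>}) = 1091" using fin order_G by (simp add: card_Diff_subset order_def)
  also have "(\<Sum>g\<in>carrier G. if g \<in> {g \<in> carrier G. ord g = 6} then 1 else 0) = card (carrier G \<inter> {g \<in> carrier G. ord g = 6})"
    using fin by (simp only: sum.inter_restrict[symmetric] card_eq_sum)
  also have "carrier G \<inter> {g \<in> carrier G. ord g = 6} = {g \<in> carrier G. ord g = 6}" by blast
  finally show ?thesis using card_ord6 by simp
qed

section \<open>Recovering the Moebius transformations\<close>

lemma conjugates_H_fix: "g \<in> conjugates (H_part A) \<Longrightarrow> \<exists>p. act g p = p"
proof -
  assume "g \<in> conjugates (H_part A)"
  then obtain k h where k: "k \<in> carrier G" "h \<in> H" "g = k \<otimes> h \<otimes> inv k" by (auto simp: conjugates_def H_part_def)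
  then have "act g (act k None) = act k None" using H_carrier[of h] by (simp add: act_mult act_inv H_def)
  then show ?thesis by blast
qed

lemma ex_Swap: "Swap \<noteq> {}"
proof -
  have "act (inv w) None \<noteq> None"
  proof
    assume "act (inv w) None = None"
    then have "act w None = None" using act_inv(2)[OF w_carrier, of None] by simp
    then show False using act_w by simp
  qed
  then obtain b where b: "act (inv w) None = Some b" by blast
  then have "act w (Some b) = None" using act_inv(2)[OF w_carrier, of None] by simp
  then have "w \<otimes> X b \<in> Swap" by (simp add: Swap_def act_mult act_w)
  then show ?thesis by blast
qed

lemma Swap_mult: "s \<in> Swap \<Longrightarrow> s \<otimes> s \<in> H"
  by (simp add: Swap_def H_def act_mult)

lemma H_pow6: "h \<in> H \<Longrightarrow> h [^] (6::nat) = \<one>"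
  using H_pow_eq_one[of h 6] H_image pow6_iff by blast

text \<open>The square of \<open>s\<close> lies in \<open>H\<close>, so the order of \<open>s\<close> divides 12. It is then 2, 3 or 6, and elements of these
  orders are conjugate into \<open>H\<close>, hence have fixed points.\<close>
lemma Swap_fixes:
  assumes s: "s \<in> Swap"
  shows "\<exists>r. r \<noteq> 0 \<and> act s (Some r) = Some r"
proof -
  have sG: "s \<in> carrier G" using s by (simp add: Swap_def)
  have "s [^] (2 * 6 :: nat) = (s [^] (2::nat)) [^] (6::nat)" using sG by (simp add: nat_pow_pow)
  also have "s [^] (2::nat) = s \<otimes> s" using sG by (simp add: numeral_2_eq_2)
  also have "(s \<otimes> s) [^] (6::nat) = \<one>" using Swap_mult[OF s] by (rule H_pow6)
  finally have "ord s dvd 12" using sG by (simp add: pow_eq_id)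
  moreover have "s \<noteq> \<one>" using s by (auto simp: Swap_def)
  then have "ord s \<noteq> 1" using ord_eq_1[OF sG] by blast
  ultimately have "ord s = 6 \<or> ord s = 2 \<or> ord s = 3" using orders[OF sG] by auto
  then obtain p where p: "act s p = p" using ord_6_conj[OF sG] ord_23_conj[OF sG] conjugates_H_fix by blast
  then obtain r where "p = Some r" using s by (cases p) (auto simp: Swap_def)
  moreover have "r \<noteq> 0" using p s calculation by (auto simp: Swap_def)
  ultimately show ?thesis using p by blast
qed

lemma Swap_conj:
  assumes s: "s \<in> Swap" and h: "h \<in> H"
  shows "s \<otimes> h \<otimes> inv s \<in> H"
proof -
  have G: "s \<in> carrier G" "h \<in> carrier G" using s h by (simp_all add: Swap_def H_def)
  have "act (inv s) (Some 0) = None" "act (inv s) None = Some 0"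
    using act_inv(1)[OF G(1), of None] act_inv(1)[OF G(1), of "Some 0"] s by (simp_all add: Swap_def)
  then show ?thesis using s h G by (simp add: H_def Swap_def act_mult)
qed

lemma Swap_scale:
  assumes s: "s \<in> Swap" and h: "h \<in> H" and b: "act s (Some b) = Some c"
  shows "act s (Some (multiplier h * b)) = Some (multiplier (s \<otimes> h \<otimes> inv s) * c)"
proof -
  have G: "s \<in> carrier G" "h \<in> carrier G" using s h by (simp_all add: Swap_def H_def)
  have "act s (Some (multiplier h * b)) = act (s \<otimes> h) (Some b)" using G h by (simp add: act_mult act_H)
  also have "s \<otimes> h = (s \<otimes> h \<otimes> inv s) \<otimes> s" using G by (simp add: m_assoc)
  also have "act \<dots> (Some b) = Some (multiplier (s \<otimes> h \<otimes> inv s) * c)"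
    using G b act_H[OF Swap_conj[OF s h]] by (simp only: act_mult m_closed inv_closed)
  finally show ?thesis .
qed

lemma ex_H: "a \<in> Sq \<Longrightarrow> \<exists>h\<in>H. multiplier h = a"
  unfolding H_image[symmetric] by blast

text \<open>Conjugation by \<open>s\<close> is an automorphism of \<open>H\<close>, which is cyclic of order 6, so multiplication by 3 is sent to
  multiplication by 3 or by 9, and multiplication by 12 to itself. In the first case the fixed point \<open>r\<close> would
  give the three fixed points \<open>r\<close>, \<open>3 * r\<close> and \<open>9 * r\<close>.\<close>
lemma Swap_inverts:
  assumes s: "s \<in> Swap" and r: "r \<noteq> 0" "act s (Some r) = Some r" and b: "act s (Some b) = Some c"
  shows "act s (Some (3 * b)) = Some (9 * c)" "act s (Some (12 * b)) = Some (12 * c)"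
proof -
  have sG: "s \<in> carrier G" using s by (simp add: Swap_def)
  have conj: "multiplier (s \<otimes> h \<otimes> inv s) ^ k = 1" "multiplier (s \<otimes> h \<otimes> inv s) \<noteq> 1"
    if h: "h \<in> H" "multiplier h \<noteq> 1" "multiplier h ^ k = 1" for h k
  proof -
    note z = Swap_conj[OF s h(1)]
    have hG: "h \<in> carrier G" using h by (simp add: H_carrier)
    have "(s \<otimes> h \<otimes> inv s) [^] k = \<one>" using sG hG h H_pow_eq_one[OF h(1), of k] by (simp add: conj_pow)
    then show "multiplier (s \<otimes> h \<otimes> inv s) ^ k = 1" using H_pow_eq_one[OF z] by simp
    show "multiplier (s \<otimes> h \<otimes> inv s) \<noteq> 1"
      using H_eq_one_iff[OF z] H_eq_one_iff[OF h(1)] h(2) conj_eq_one_iff[OF sG hG] by simp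
  qed
  obtain h where h: "h \<in> H" "multiplier h = 3" using ex_H[of 3] by (auto simp: Sq_def)
  let ?t = "multiplier (s \<otimes> h \<otimes> inv s)"
  have "?t = 3 \<or> ?t = 9" using conj[of h 3] pow3_13[of ?t] h by (simp add: numeral_eq13)
  moreover have "?t \<noteq> 3"
  proof
    assume t: "?t = 3"
    have 3: "act s (Some (3 * b)) = Some (3 * c)" if "act s (Some b) = Some c" for b c
      using Swap_scale[OF s h(1) that] h(2) t by simp
    have "s = \<one>"
      by (rule fixes_three_points[of s "Some r" "Some (3 * r)" "Some (3 * (3 * r))"])
        (use sG r 3[OF r(2)] 3[OF 3[OF r(2)]] in \<open>simp_all add: numeral_eq13\<close>)
    then show False using s by (auto simp: Swap_def)
  qed
  ultimately show "act s (Some (3 * b)) = Some (9 * c)" using Swap_scale[OF s h(1) b] h(2) by simp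
  obtain k where k: "k \<in> H" "multiplier k = 12" using ex_H[of 12] by (auto simp: Sq_def)
  have "multiplier (s \<otimes> k \<otimes> inv s) = 12" using conj[of k 2] pow2_13[of "multiplier (s \<otimes> k \<otimes> inv s)"] k by (simp add: numeral_eq13)
  then show "act s (Some (12 * b)) = Some (12 * c)" using Swap_scale[OF s k(1) b] k(2) by simp
qed

text \<open>Take \<open>s\<close> in \<open>Swap\<close> with fixed point \<open>r\<close> and compose it with multiplication by 12, that is, by \<open>-1\<close>. In the
  coordinate \<open>b\<close> with \<open>r * b\<close> as the label of the point, the result \<open>V\<close> satisfies the hypotheses of
  \<open>neg_inverse_unique\<close>. The relation among its values comes from the element \<open>u\<close> acting as \<open>b \<mapsto> V b + 1\<close>:
  it permutes infinity, 0 and 1 cyclically, hence its cube is the identity.\<close>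
lemma ex_neg_inverse:
  "\<exists>r v. r \<noteq> 0 \<and> v \<in> Swap \<and> (\<forall>b. b \<noteq> 0 \<longrightarrow> act v (Some (r * b)) = Some (r * (12 / b)))"
proof -
  obtain s where s: "s \<in> Swap" using ex_Swap by blast
  obtain r where r: "r \<noteq> 0" "act s (Some r) = Some r" using Swap_fixes[OF s] by blast
  have sG: "s \<in> carrier G" using s by (simp add: Swap_def)
  obtain k where k: "k \<in> H" "multiplier k = 12" using ex_H[of 12] by (auto simp: Sq_def)
  have kG: "k \<in> carrier G" using k by (simp add: H_carrier)
  define v where "v = k \<otimes> s"
  have vG: "v \<in> carrier G" using kG sG by (simp add: v_def)
  have v: "v \<in> Swap" using s k kG sG by (simp add: v_def Swap_def act_mult H_def)
  define V where "V b = the (act v (Some (r * b))) / r" for b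
  have act_V: "act v (Some (r * b)) = Some (r * V b)" if "b \<noteq> 0" for b
  proof -
    have "act v (Some (r * b)) \<noteq> None"
      using act_inj[OF vG, of "Some (r * b)" "Some 0"] v that r(1) by (auto simp: Swap_def)
    then show ?thesis using r(1) by (auto simp: V_def)
  qed
  have step: "V (3 * b) = 9 * V b \<and> V (12 * b) = 12 * V b" if "b \<noteq> 0" for b
  proof -
    have "act s (Some (r * b)) \<noteq> None"
      using act_inj[OF sG, of "Some (r * b)" "Some 0"] s that r(1) by (auto simp: Swap_def)
    then obtain c where c: "act s (Some (r * b)) = Some c" by blast
    have av: "act v (Some d) = Some (12 * e)" if "act s (Some d) = Some e" for d e
      using that kG sG act_H[OF k(1)] k(2) by (simp add: v_def act_mult)
    have "act v (Some (r * b)) = Some (12 * c)" "act v (Some (r * (3 * b))) = Some (12 * (9 * c))"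
      "act v (Some (r * (12 * b))) = Some (12 * (12 * c))"
      using av[OF c] av[OF Swap_inverts(1)[OF s r c]] av[OF Swap_inverts(2)[OF s r c]]
      by (simp_all add: mult.left_commute[of r])
    then show ?thesis using r(1) by (simp add: V_def)
  qed
  have "V 1 = 12"
    using r kG sG act_H[OF k(1), of r] k(2) by (simp add: V_def v_def act_mult)
  moreover have inj: "b = c" if "b \<noteq> 0" "c \<noteq> 0" "V b = V c" for b c
    using act_inj[OF vG, of "Some (r * b)" "Some (r * c)"] act_V that r(1) by simp
  moreover have nz: "V b \<noteq> 0" if "b \<noteq> 0" for b
  proof
    assume "V b = 0"
    then have "act v (Some (r * b)) = act v None" using act_V[OF that] v by (simp add: Swap_def)
    then show False using act_inj[OF vG] by simp
  qed
  moreover have "V (V (V 2 + 1) + 1) + 1 = 2"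
  proof -
    let ?u = "X r \<otimes> v"
    have uG: "?u \<in> carrier G" using vG by simp
    have uN: "act ?u None = Some r" and u0: "act ?u (Some 0) = None"
      using v vG by (simp_all add: act_mult Swap_def)
    have uS: "act ?u (Some (r * b)) = Some (r * (V b + 1))" if "b \<noteq> 0" for b
      using act_V[OF that] vG by (simp add: act_mult algebra_simps)
    have u1: "act ?u (Some r) = Some 0"
      using uS[of 1] \<open>V 1 = 12\<close> by (simp add: twelve)
    let ?g = "?u \<otimes> ?u \<otimes> ?u"
    have g: "act ?g p = act ?u (act ?u (act ?u p))" for p using uG by (simp add: act_mult)
    have "?g = \<one>"
      by (rule fixes_three_points[of ?g None "Some 0" "Some r"])
        (use uG r(1) in \<open>simp_all add: g uN u0 u1\<close>)
    then have "act ?u (act ?u (act ?u (Some (r * 2)))) = Some (r * 2)" using g by (metis act_one)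
    moreover have 2: "(2 :: 'f) \<noteq> 0" by (simp add: numeral_eq13)
    moreover have n1: "V 2 + 1 \<noteq> 0"
    proof
      assume "V 2 + 1 = 0"
      then have "V 2 + 1 = V 1 + 1" using \<open>V 1 = 12\<close> by (simp add: twelve)
      then have "V 2 = V 1" by (simp only: add_right_cancel)
      then have "(2 :: 'f) = 1" using inj[of 2 1] 2 by simp
      then show False by (simp add: numeral_eq13)
    qed
    moreover have n2: "V (V 2 + 1) + 1 \<noteq> 0"
    proof
      assume "V (V 2 + 1) + 1 = 0"
      then have "V (V 2 + 1) + 1 = V 1 + 1" using \<open>V 1 = 12\<close> by (simp add: twelve)
      then have "V (V 2 + 1) = V 1" by (simp only: add_right_cancel)
      then have "V 2 + 1 = 1" using inj[of "V 2 + 1" 1] n1 by simp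
      then show False using nz[OF 2] by simp
    qed
    ultimately show ?thesis using r(1) by (simp add: uS)
  qed
  ultimately have "b * V b = 12" if "b \<noteq> 0" for b
    using neg_inverse_unique[of V b] step that by blast
  then have "act v (Some (r * b)) = Some (r * (12 / b))" if "b \<noteq> 0" for b
    using act_V[OF that] that by (metis nonzero_mult_div_cancel_left)
  then show ?thesis using r(1) v by blast
qed

text \<open>After scaling by \<open>r\<close>, the normalizer and \<open>v\<close> act by elements of \<open>Mob\<close>, and together they generate \<open>G\<close>. The
  resulting injection into \<open>Mob\<close> is onto because both groups have order 1092.\<close>
theorem iso_Mob: "G \<cong> (Mob :: ('f option \<Rightarrow> 'f option) monoid)"
proof -
  obtain r v where r: "r \<noteq> 0" and v: "v \<in> Swap"
    and vb: "\<And>b. b \<noteq> 0 \<Longrightarrow> act v (Some (r * b)) = Some (r * (12 / b))" using ex_neg_inverse by blast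
  have vG: "v \<in> carrier G" using v by (simp add: Swap_def)
  define D where "D = map_option (\<lambda>b. r * b)"
  define D' where "D' = map_option (\<lambda>b. b / r)"
  define \<Phi> where "\<Phi> g = D' \<circ> act g \<circ> D" for g
  have DD: "D (D' p) = p" "D' (D p) = p" for p using r by (cases p; simp add: D_def D'_def)+
  have hom: "\<Phi> (g \<otimes> h) = \<Phi> g \<circ> \<Phi> h" if "g \<in> carrier G" "h \<in> carrier G" for g h
    using that by (auto simp: \<Phi>_def act_mult DD)
  have PhiN: "\<Phi> n \<in> carrier Mob" if n: "n \<in> normalizer x" for n
  proof -
    obtain c where c: "\<And>b. act n (Some b) = Some (multiplier n * b + c)" using act_N[OF n] by blast
    have "multiplier n \<in> Sq" using multiplier_image n by blast
    then obtain t where t: "t \<noteq> 0" "multiplier n = t * t" using Sq_square by blast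
    have "act n None = None" using act_None_iff N_carrier n by blast
    then have "\<Phi> n p = mob (mat2 t (c / r / t) 0 (1 / t)) p" for p
      using c t r by (cases p) (simp_all add: \<Phi>_def D_def D'_def mob_mat2_None mob_mat2_Some field_simps)
    then have "\<Phi> n = mob (mat2 t (c / r / t) 0 (1 / t))" by blast
    moreover have "t * (1 / t) - (c / r / t) * 0 = 1" using t by simp
    ultimately show ?thesis unfolding Mob_carrier_mat2 by blast
  qed
  have Phiv: "\<Phi> v \<in> carrier Mob"
  proof -
    have "\<Phi> v p = mob (mat2 0 (-1) 1 0) p" for p
    proof (cases p)
      case (Some b)
      then show ?thesis using vb[of b] v r
        by (cases "b = 0") (simp_all add: \<Phi>_def D_def D'_def mob_mat2_Some Swap_def twelve)
    qed (use v in \<open>simp add: \<Phi>_def D_def D'_def mob_mat2_None Swap_def\<close>)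
    then have "\<Phi> v = mob (mat2 0 (-1) 1 0)" by blast
    moreover have "0 * 0 - (-1) * 1 = (1 :: 'f)" by simp
    ultimately show ?thesis unfolding Mob_carrier_mat2 by blast
  qed
  have Phi: "\<Phi> g \<in> carrier Mob" if g: "g \<in> carrier G" for g
  proof (cases "act g None")
    case None
    then show ?thesis using PhiN act_None_iff g by blast
  next
    case (Some b)
    define n where "n = inv v \<otimes> (X (- b) \<otimes> g)"
    have nG: "n \<in> carrier G" using g vG by (simp add: n_def)
    have "act (inv v) (Some 0) = None" using act_inv(1)[OF vG, of None] v by (simp add: Swap_def)
    then have "act n None = None" using g vG Some by (simp add: n_def act_mult)
    then have n: "n \<in> normalizer x" using act_None_iff nG by blast
    have "X b \<otimes> (v \<otimes> n) = X b \<otimes> (X (- b) \<otimes> g)" using g vG by (simp add: n_def inv_mult_cancel)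
    also have "\<dots> = g" using g by (simp add: inv_mult_cancel flip: X_minus)
    finally have "\<Phi> g = \<Phi> (X b) \<circ> (\<Phi> v \<circ> \<Phi> n)" using vG nG hom by (metis X_carrier m_closed)
    then show ?thesis using PhiN[OF X_N] Phiv PhiN[OF n] by (simp add: Mob_mult_closed)
  qed
  have "inj_on \<Phi> (carrier G)"
  proof (rule inj_onI)
    fix g h assume gh: "g \<in> carrier G" "h \<in> carrier G" "\<Phi> g = \<Phi> h"
    have "act g p = act h p" for p
    proof -
      have "D (\<Phi> g (D' p)) = D (\<Phi> h (D' p))" using gh by simp
      then show ?thesis by (simp add: \<Phi>_def DD)
    qed
    then show "g = h" using act_faithful gh by blast
  qed
  moreover from this have "\<Phi> ` carrier G = carrier Mob"
    using Phi order_Mob order_G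
    by (intro card_subset_eq) (auto simp: card_image order_def intro: card_ge_0_finite)
  ultimately have "\<Phi> \<in> iso G Mob"
    using hom Phi by (auto simp: iso_def bij_betw_def hom_def Mob_def)
  then show ?thesis by (auto simp: is_iso_def)
qed

end

section \<open>The value for the group of Moebius transformations\<close>

lemma ord_iso:
  assumes "group G" "group H" "h \<in> iso G H" "x \<in> carrier G"
  shows "group.ord H (h x) = group.ord G x"
proof -
  interpret G: group G by fact
  interpret H: group H by fact
  interpret group_hom G H h
    using assms by (intro group_hom.intro group_hom_axioms.intro) (auto simp: iso_def)
  have inj: "inj_on h (carrier G)" using assms(3) by (simp add: iso_def bij_betw_def)
  have "h x [^]\<^bsub>H\<^esub> n = \<one>\<^bsub>H\<^esub> \<longleftrightarrow> G.ord x dvd n" for n :: nat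
  proof -
    have "h x [^]\<^bsub>H\<^esub> n = h (x [^]\<^bsub>G\<^esub> n)" using assms(4) by (simp add: hom_nat_pow)
    also have "\<dots> = \<one>\<^bsub>H\<^esub> \<longleftrightarrow> x [^]\<^bsub>G\<^esub> n = \<one>\<^bsub>G\<^esub>"
      using inj_on_eq_iff[OF inj, of "x [^]\<^bsub>G\<^esub> n" "\<one>\<^bsub>G\<^esub>"] assms(4) by simp
    also have "\<dots> \<longleftrightarrow> G.ord x dvd n" using assms(4) by (rule G.pow_eq_id)
    finally show ?thesis .
  qed
  then show ?thesis using assms(4) by (subst H.ord_unique) auto
qed

lemma Omega_rho_iso:
  assumes "group G" "group H" "G \<cong> H"
  shows "Omega_rho G = Omega_rho H"
proof -
  obtain h where h: "h \<in> iso G H" using assms(3) by (auto simp: is_iso_def)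
  then have "bij_betw h (carrier G) (carrier H)" by (simp add: iso_def)
  then have "rho H = (\<Prod>x\<in>carrier G. group.ord H (h x))"
    unfolding rho_def by (rule prod.reindex_bij_betw[symmetric])
  also have "\<dots> = rho G" unfolding rho_def using ord_iso[OF assms(1,2) h] by (intro prod.cong) auto
  finally show ?thesis by (simp add: Omega_rho_def)
qed

context field13
begin

definition shift :: "'f option \<Rightarrow> 'f option" where "shift = map_option (\<lambda>z. z + 1)"

definition neg_inv :: "'f option \<Rightarrow> 'f option" where "neg_inv = mob (mat2 0 (-1) 1 0)"

lemma neg_inv_apply: "neg_inv None = Some 0" "neg_inv (neg_inv p) = p"
  by (simp add: neg_inv_def mob_mat2_None, cases p) (auto simp: neg_inv_def mob_mat2_None mob_mat2_Some)

lemma shift_fixed: "shift p = p \<longleftrightarrow> p = None"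
  by (cases p) (simp_all add: shift_def)

lemma shift_carrier: "shift \<in> carrier Mob"
proof -
  have "shift p = mob (mat2 1 1 0 1) p" for p
    by (cases p) (simp_all add: shift_def mob_mat2_None mob_mat2_Some)
  then have "shift = mob (mat2 1 1 0 1)" by blast
  then show ?thesis by (auto simp: Mob_def det_mat2)
qed

lemma neg_inv_carrier: "neg_inv \<in> carrier Mob"
  by (auto simp: Mob_def neg_inv_def det_mat2)

lemma shift_pow: "shift [^]\<^bsub>Mob\<^esub> (k::nat) = map_option (\<lambda>z. z + of_nat k)"
proof (induction k)
  case 0
  then show ?case by (simp add: Mob_def option.map_id[unfolded id_def] id_def)
next
  case (Suc k)
  have "(map_option (\<lambda>z. z + of_nat k) \<circ> shift) p = map_option (\<lambda>z. z + of_nat (Suc k)) p" for p :: "'f option"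
    by (cases p) (simp_all add: shift_def algebra_simps)
  then have "map_option (\<lambda>z. z + of_nat k) \<circ> shift = map_option (\<lambda>z :: 'f. z + of_nat (Suc k))" by blast
  then show ?case unfolding nat_pow_Suc Suc by (simp add: Mob_def)
qed

sublocale Mob: group "Mob :: ('f option \<Rightarrow> 'f option) monoid" by (rule group_Mob)

lemma ord_shift: "Mob.ord shift = 13"
proof (rule Mob.ord_prime_if[OF shift_carrier])
  show "prime (13::nat)" by (simp add: prime_nat_numeral_eq)
  have "of_nat 13 = (0 :: 'f)" using of_nat_eq13[of 13 0] by simp
  then show "shift [^]\<^bsub>Mob\<^esub> (13::nat) = \<one>\<^bsub>Mob\<^esub>"
    unfolding shift_pow by (simp add: Mob_def fun_eq_iff option.map_ident)
  show "shift \<noteq> \<one>\<^bsub>Mob\<^esub>" using shift_fixed[of "Some 0"] by (auto simp: Mob_def)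
qed

text \<open>A map that commutes with the shift fixes infinity, the only fixed point of the shift, so it is affine; commuting
  makes its slope 1.\<close>
lemma centralizer_shift: "Mob.centralizer shift = Mob.powers shift"
proof
  show "Mob.powers shift \<subseteq> Mob.centralizer shift" using shift_carrier by (rule Mob.powers_le_centralizer)
  show "Mob.centralizer shift \<subseteq> Mob.powers shift"
  proof
    fix f assume f: "f \<in> Mob.centralizer shift"
    then have com: "f (shift p) = shift (f p)" for p
      unfolding Mob.centralizer_def by (auto simp: Mob_def dest: fun_cong)
    have "f \<in> carrier Mob" using f by (simp add: Mob.centralizer_def)
    then obtain a b c d where A: "a * d - b * c = 1" "f = mob (mat2 a b c d)"
      unfolding Mob_carrier_mat2 by blast
    have "shift (f None) = f None" using com[of None] by (simp add: shift_def)
    then have "f None = None" by (simp add: shift_fixed)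
    then have c: "c = 0" by (auto simp: A(2) mob_mat2_None split: if_splits)
    then have d: "d \<noteq> 0" using A(1) by auto
    have fS: "f (Some z) = Some ((a * z + b) / d)" for z using c d by (simp add: A(2) mob_mat2_Some)
    have "(a + b) / d = b / d + 1" using com[of "Some 0"] by (simp add: shift_def fS)
    then have "a = d" using d by (simp add: field_simps)
    obtain k where k: "b / d = of_nat k" using UNIV13 by blast
    have "f p = map_option (\<lambda>z. z + of_nat k) p" for p
      using \<open>f None = None\<close> fS \<open>a = d\<close> d by (cases p) (simp_all add: add_divide_distrib k)
    then have "f = shift [^]\<^bsub>Mob\<^esub> k" unfolding shift_pow by blast
    then show "f \<in> Mob.powers shift" unfolding Mob.mem_powers by blast
  qed
qed

text \<open>Otherwise \<open>neg_inv \<circ> shift \<circ> neg_inv\<close> would be a translation and fix infinity, so the shift would fix 0.\<close>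
lemma neg_inv_notin: "neg_inv \<notin> Mob.normalizer shift"
proof
  assume "neg_inv \<in> Mob.normalizer shift"
  moreover have "inv\<^bsub>Mob\<^esub> neg_inv = neg_inv"
    by (rule Mob.inv_equality) (auto simp: Mob_def neg_inv_carrier[unfolded Mob_def, simplified] neg_inv_apply)
  ultimately obtain k :: nat where "neg_inv \<circ> shift \<circ> neg_inv = map_option (\<lambda>z. z + of_nat k)"
    unfolding Mob.normalizer_def Mob.mem_powers shift_pow by (auto simp: Mob_def)
  then have "neg_inv (shift (neg_inv None)) = None" by (metis comp_apply option.map_disc_iff)
  then have "shift (neg_inv None) = neg_inv None" using neg_inv_apply(2) by metis
  then show False by (simp add: shift_fixed neg_inv_apply(1))
qed

lemma self_centralizing13_Mob: "self_centralizing13 TYPE('f) Mob shift neg_inv"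
proof (intro self_centralizing13.intro group1092.intro self_centralizing13_axioms.intro group1092_axioms.intro)
  show "field13 TYPE('f)" by (rule field13_axioms)
qed (use group_Mob order_Mob shift_carrier ord_shift neg_inv_carrier neg_inv_notin centralizer_shift in auto)

lemma Omega_rho_Mob: "Omega_rho (Mob :: ('f option \<Rightarrow> 'f option) monoid) = 1273"
  using self_centralizing13_Mob by (rule self_centralizing13.Omega_rho_1273)

end

theorem theorem2p16:
  fixes G :: "('a, 'b) monoid_scheme"
  assumes "CARD('f::field) = 13"
    and "group G"
    and "order G = 1092"
  shows "Omega_rho (L2 TYPE('f)) \<le> Omega_rho G \<and>
         (Omega_rho G = 1273 \<longleftrightarrow> G \<cong> L2 TYPE('f))"
proof -
  interpret field13 "TYPE('f)" using assms(1) by unfold_locales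
  interpret G: group G by fact
  have L2: "group (L2 TYPE('f))" unfolding L2_def by (rule group_PSL)
  have L2_1273: "Omega_rho (L2 TYPE('f)) = 1273"
    using Omega_rho_iso[OF L2 group_Mob L2_iso_Mob] Omega_rho_Mob by simp
  have "finite (carrier G)" using assms(3) by (metis card.infinite order_def zero_neq_numeral)
  then obtain x where x: "x \<in> carrier G" "G.ord x = 13"
    using G.Cauchy[of 13] assms(3) by (auto simp: prime_nat_numeral_eq)
  interpret group1092 G "TYPE('f)" x using assms(3) x by unfold_locales auto
  show ?thesis
  proof (cases "G.normalizer x = carrier G \<or> G.centralizer x \<noteq> G.powers x")
    case True
    then have "1273 < Omega_rho G" by (rule Omega_rho_gt)
    then show ?thesis using Omega_rho_iso[OF assms(2) L2] L2_1273 by auto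
  next
    case False
    then obtain w where "w \<in> carrier G" "w \<notin> G.normalizer x"
      using subgroup.subset[OF N_sub] by blast
    then interpret self_centralizing13 G "TYPE('f)" x w using False by unfold_locales auto
    have "G \<cong> L2 TYPE('f)"
      using iso_Mob group.iso_sym[OF L2 L2_iso_Mob] by (rule iso_trans)
    then show ?thesis using Omega_rho_1273 L2_1273 by simp
  qed
qed

end
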